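(* Let $0<\gamma<1$ satisfy $$K(\sigma_* )\,\gamma^\alpha\,2^{2d+1}\le\tfrac12,\qquad \sigma_*:=2d+1 .$$ For a given $\lambda\ge 1$ let $\mathcal{X}_\delta$ be a maximal $\delta$-net on $M$ with $\delta:=\gamma/\lambda$ and suppose $\{A_\xi\}_{\xi\in\mathcal{X}_\delta}$ is a disjoint partition of $M$ consisting of measurable sets such that $B(\xi,\delta/2)\subset A_\xi\subset B(\xi,\delta)$ for $\xi\in\mathcal{X}_\delta$. Then for any $f\in\Sigma_\lambda^p$, $1\le p<\infty$, $$\tfrac12\|f\|_p\le\Big(\sum_{\xi\in\mathcal{X}_\delta}|A_\xi||f(\xi)|^p\Big)^{1/p}\le 2\|f\|_p,$$ and for $f\in\Sigma_\lambda^\infty$ $$\tfrac12\|f\|_\infty\le\sup_{\xi\in\mathcal{X}_\delta}|f(\xi)|\le\|f\|_\infty .$$ Furthermore, if for a given $0<\varepsilon<1$ the constant $0<\gamma<1$ is selected so that $$K(\sigma_* )\,\gamma^\alpha\,2^{2d+1}\le\tfrac{\varepsilon}{3}$$ (instead of the condition above), then for any $f\in\Sigma_\lambda^p$, $1\le p\le 2$, $$(1-\varepsilon)\|f\|_p^p\le\sum_{\xi\in\mathcal{X}_\delta}|A_\xi||f(\xi)|^p\le(1+\varepsilon)\|f\|_p^p .$$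
   Context: Setting. $\mathbb{R}_+=[0,\infty)$. $(M,\rho,\mu)$ is a locally compact metric space with distance $\rho$ and a positive Radon measure $\mu$; $B(x,r)$ is the open ball, $|E|:=\mu(E)$, $\|\cdot\|_p$ is the norm of $L^p:=L^p(M,\mu)$. Assume: (a) doubling: for some $d>0$, $0<|B(x,2r)|\le 2^d|B(x,r)|<\infty$ for $x\in M$, $r>0$; (b) reverse doubling: for some $\beta>0$, $|B(x,2r)|\ge 2^\beta|B(x,r)|$ for $x\in M$, $0<r\le \frac{\operatorname{diam}M}{3}$; (c) non-collapsing: $\inf_{x\in M}|B(x,1)|\ge c>0$. $L$ is an essentially self-adjoint positive operator on $L^2(M,\mu)$ (its closure is also denoted $L$) such that the semigroup $e^{-tL}$ consists of integral operators with (heat) kernel $p_t(x,y)$ satisfying, with constants $C,c>0$: (d) $p_t(x,y)\le \frac{C\exp\{-c\rho^2(x,y)/t\}}{\sqrt{|B(x,\sqrt t)||B(y,\sqrt t)|}}$ for $x,y\in M$, $0<t\le 1$ (which with doubling and holomorphy of the semigroup gives $|p_z(x,y)|\le \frac{C\exp\{-c\,\mathrm{Re}\,(\rho^2(x,y)/z)\}}{\sqrt{|B(x,\sqrt t)||B(y,\sqrt t)|}}$ for $z=t+iu$, $0<t\le 1$, $u\in\mathbb{R}$); (e) H\"older continuity: for some $\alpha>0$, $|p_t(x,y)-p_t(x,y')|\le C\big(\frac{\rho(y,y')}{\sqrt t}\big)^\alpha\frac{\exp\{-c\rho^2(x,y)/t\}}{\sqrt{|B(x,\sqrt t)||B(y,\sqrt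 t)|}}$ for $0<t\le1$, $\rho(y,y')\le\sqrt t$; (f) Markov property: $\int_M p_t(x,y)\,d\mu(y)=1$ for $t>0$. Notation. $D_{\delta,\sigma}(x,y):=(|B(x,\delta)||B(y,\delta)|)^{-1/2}(1+\rho(x,y)/\delta)^{-\sigma}$. The constant $K(\sigma)$: fix a cut-off function $\varphi\in C^\infty(\mathbb{R}_+)$ with $\operatorname{supp}\varphi\subset[0,b]$ for some $b>1$, $0\le\varphi\le1$, $\varphi=1$ on $[0,1]$. For each $\sigma>0$, $K(\sigma)>1$ is a constant (independent of $x,x',y,\delta$) such that for all $0<\delta\le1$ and $x,x',y\in M$ the kernel of $\varphi(\delta\sqrt L)$ satisfies $|\varphi(\delta\sqrt L)(x,y)|\le K(\sigma)D_{\delta,\sigma}(x,y)$ and $|\varphi(\delta\sqrt L)(x,y)-\varphi(\delta\sqrt L)(x',y)|\le K(\sigma)(\rho(x,x')/\delta)^\alpha D_{\delta,\sigma}(x,y)$ if $\rho(x,x')\le\delta$; here $\alpha$ is the exponent in (e). Spectral spaces: for $\lambda>0$, $1\le p\le\infty$, $\Sigma_\lambda^p:=\{f\in L^p:\theta(\sqrt L)f=f$ for all $\theta\in C_0^\infty(\mathbb{R}_+)$ with $\theta\equiv1$ on $[0,\lambda]\}$, where $C_0^\infty(\mathbb{R}_+)$ is the set of compactly supported $C^\infty$ functions on $[0,\infty)$ and $\theta(\sqrt L)$ acts on $L^p$ through its integral kernel. Elements of $\Sigma_\lambda^p$ are identified with their continuous representatives. A set $\mathcal{X}\subset M$ is a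 $\delta$-net if $\rho(\xi,\eta)\ge\delta$ for all distinct $\xi,\eta\in\mathcal{X}$, and a maximal $\delta$-net if it is a $\delta$-net that cannot be enlarged; such nets are at most countable and partitions $\{A_\xi\}$ as in the claim always exist. *)

theory Defs
  imports "HOL-Analysis.Analysis" "HOL-Probability.Essential_Supremum"
begin

section \<open>Lebesgue spaces\<close>

text \<open>
  Elements of \<open>L\<^sup>p\<close> are represented by complex-valued measurable functions; equality in \<open>L\<^sup>p\<close>
  is equality almost everywhere. The exponent ranges over \<open>ennreal\<close> so that \<open>p = \<infinity>\<close> is included.
\<close>

definition ess_bound :: "'a measure \<Rightarrow> ('a \<Rightarrow> complex) \<Rightarrow> ennreal" where
  "ess_bound \<mu> f = esssup \<mu> (\<lambda>x. ennreal (norm (f x)))"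

definition Lp_space :: "'a measure \<Rightarrow> ennreal \<Rightarrow> ('a \<Rightarrow> complex) set" where
  "Lp_space \<mu> p = {f \<in> borel_measurable \<mu>.
     if p = \<infinity> then ess_bound \<mu> f < \<infinity> else integrable \<mu> (\<lambda>x. norm (f x) powr enn2real p)}"

definition Lp_norm :: "'a measure \<Rightarrow> ennreal \<Rightarrow> ('a \<Rightarrow> complex) \<Rightarrow> real" where
  "Lp_norm \<mu> p f =
     (if p = \<infinity> then enn2real (ess_bound \<mu> f)
      else (LINT x|\<mu>. norm (f x) powr enn2real p) powr (1 / enn2real p))"

abbreviation L2 :: "'a measure \<Rightarrow> ('a \<Rightarrow> complex) set" where
  "L2 \<mu> \<equiv> Lp_space \<mu> 2"

definition L2_inner :: "'a measure \<Rightarrow> ('a \<Rightarrow> complex) \<Rightarrow> ('a \<Rightarrow> complex) \<Rightarrow> complex" where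
  "L2_inner \<mu> f g = (LINT x|\<mu>. f x * cnj (g x))"


section \<open>Unbounded operators on \<open>L\<^sup>2\<close>\<close>

text \<open>
  An operator is given by its graph, a set of pairs of functions that is saturated under equality
  almost everywhere.
\<close>

type_synonym 'a op_graph = "(('a \<Rightarrow> complex) \<times> ('a \<Rightarrow> complex)) set"

definition densely_defined_operator :: "'a measure \<Rightarrow> 'a op_graph \<Rightarrow> bool" where
  "densely_defined_operator \<mu> G \<longleftrightarrow>
     G \<subseteq> L2 \<mu> \<times> L2 \<mu> \<and>
     (\<forall>(f, g) \<in> G. \<forall>f' \<in> L2 \<mu>. \<forall>g' \<in> L2 \<mu>.
        (AE x in \<mu>. f x = f' x) \<longrightarrow> (AE x in \<mu>. g x = g' x) \<longrightarrow> (f', g') \<in> G) \<and>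
     (\<forall>(f, g) \<in> G. \<forall>(f', g') \<in> G. \<forall>a b.
        ((\<lambda>x. a * f x + b * f' x), (\<lambda>x. a * g x + b * g' x)) \<in> G) \<and>
     (\<forall>(f, g) \<in> G. (AE x in \<mu>. f x = 0) \<longrightarrow> (AE x in \<mu>. g x = 0)) \<and>
     (\<forall>h \<in> L2 \<mu>. \<forall>e > 0. \<exists>(f, g) \<in> G. Lp_norm \<mu> 2 (\<lambda>x. h x - f x) < e)"

definition op_closure :: "'a measure \<Rightarrow> 'a op_graph \<Rightarrow> 'a op_graph" where
  "op_closure \<mu> G = {(f, g) \<in> L2 \<mu> \<times> L2 \<mu>. \<forall>e > 0. \<exists>(u, v) \<in> G.
     Lp_norm \<mu> 2 (\<lambda>x. f x - u x) < e \<and> Lp_norm \<mu> 2 (\<lambda>x. g x - v x) < e}"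

definition op_adjoint :: "'a measure \<Rightarrow> 'a op_graph \<Rightarrow> 'a op_graph" where
  "op_adjoint \<mu> G = {(u, v) \<in> L2 \<mu> \<times> L2 \<mu>. \<forall>(f, g) \<in> G. L2_inner \<mu> g u = L2_inner \<mu> f v}"

definition self_adjoint :: "'a measure \<Rightarrow> 'a op_graph \<Rightarrow> bool" where
  "self_adjoint \<mu> G \<longleftrightarrow> densely_defined_operator \<mu> G \<and> op_adjoint \<mu> G = G"

definition essentially_self_adjoint :: "'a measure \<Rightarrow> 'a op_graph \<Rightarrow> bool" where
  "essentially_self_adjoint \<mu> G \<longleftrightarrow>
     densely_defined_operator \<mu> G \<and> self_adjoint \<mu> (op_closure \<mu> G)"

definition positive_operator :: "'a measure \<Rightarrow> 'a op_graph \<Rightarrow> bool" where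
  "positive_operator \<mu> G \<longleftrightarrow>
     (\<forall>(f, g) \<in> G. Im (L2_inner \<mu> g f) = 0 \<and> 0 \<le> Re (L2_inner \<mu> g f))"


section \<open>Spectral resolution and functional calculus\<close>

text \<open>
  Only positive operators are considered, so spectral measures are concentrated on \<open>[0,\<infinity>)\<close>.
  Linearity of \<open>E S\<close> and its compatibility with equality almost everywhere follow from its symmetry
  on all of \<open>L\<^sup>2\<close>.
\<close>

definition projection_valued_measure ::
    "'a measure \<Rightarrow> (real set \<Rightarrow> ('a \<Rightarrow> complex) \<Rightarrow> ('a \<Rightarrow> complex)) \<Rightarrow> bool" where
  "projection_valued_measure \<mu> E \<longleftrightarrow>
     (\<forall>S \<in> sets borel. \<forall>f \<in> L2 \<mu>. E S f \<in> L2 \<mu>) \<and>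
     (\<forall>S \<in> sets borel. \<forall>f \<in> L2 \<mu>. \<forall>g \<in> L2 \<mu>. L2_inner \<mu> (E S f) g = L2_inner \<mu> f (E S g)) \<and>
     (\<forall>S \<in> sets borel. \<forall>T \<in> sets borel. \<forall>f \<in> L2 \<mu>. AE x in \<mu>. E S (E T f) x = E (S \<inter> T) f x) \<and>
     (\<forall>f \<in> L2 \<mu>. AE x in \<mu>. E {0..} f x = f x) \<and>
     (\<forall>S :: nat \<Rightarrow> real set. range S \<subseteq> sets borel \<longrightarrow> disjoint_family S \<longrightarrow>
        (\<forall>f \<in> L2 \<mu>. \<forall>g \<in> L2 \<mu>.
           (\<lambda>n. L2_inner \<mu> (E (S n) f) g) sums L2_inner \<mu> (E (\<Union>n. S n) f) g))"

text \<open>The finite measure \<open>S \<mapsto> \<langle>E(S) f, f\<rangle>\<close>.\<close>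

definition spectral_measure ::
    "'a measure \<Rightarrow> (real set \<Rightarrow> ('a \<Rightarrow> complex) \<Rightarrow> ('a \<Rightarrow> complex)) \<Rightarrow> ('a \<Rightarrow> complex) \<Rightarrow> real measure"
  where
  "spectral_measure \<mu> E f =
     measure_of UNIV (sets borel) (\<lambda>S. ennreal (Re (L2_inner \<mu> (E S f) f)))"

text \<open>
  \<open>\<integral> F(s) d\<langle>E(s) f, h\<rangle>\<close> over \<open>[0,\<infinity>)\<close>; the complex measure \<open>S \<mapsto> \<langle>E(S) f, h\<rangle>\<close> is written
  through positive measures by polarization.
\<close>

definition spectral_form ::
    "'a measure \<Rightarrow> (real set \<Rightarrow> ('a \<Rightarrow> complex) \<Rightarrow> ('a \<Rightarrow> complex)) \<Rightarrow> (real \<Rightarrow> real) \<Rightarrow>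
     ('a \<Rightarrow> complex) \<Rightarrow> ('a \<Rightarrow> complex) \<Rightarrow> complex" where
  "spectral_form \<mu> E F f h =
     (\<Sum>k<4. \<i> ^ k *
        complex_of_real (LINT s:{0..}|spectral_measure \<mu> E (\<lambda>x. f x + \<i> ^ k * h x). F s)) / 4"

definition spectral_domain ::
    "'a measure \<Rightarrow> (real set \<Rightarrow> ('a \<Rightarrow> complex) \<Rightarrow> ('a \<Rightarrow> complex)) \<Rightarrow> ('a \<Rightarrow> complex) set" where
  "spectral_domain \<mu> E =
     {f \<in> L2 \<mu>. set_integrable (spectral_measure \<mu> E f) {0..} (\<lambda>s. s\<^sup>2)}"

text \<open>
  \<open>A = \<integral> s dE(s)\<close>. The test functions \<open>h\<close> range over the (dense) domain, where all four integrals
  of the polarization formula converge.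
\<close>

definition spectral_resolution ::
    "'a measure \<Rightarrow> 'a op_graph \<Rightarrow> (real set \<Rightarrow> ('a \<Rightarrow> complex) \<Rightarrow> ('a \<Rightarrow> complex)) \<Rightarrow> bool" where
  "spectral_resolution \<mu> A E \<longleftrightarrow>
     projection_valued_measure \<mu> E \<and>
     A = {(f, g). f \<in> spectral_domain \<mu> E \<and> g \<in> L2 \<mu> \<and>
            (\<forall>h \<in> spectral_domain \<mu> E. L2_inner \<mu> g h = spectral_form \<mu> E (\<lambda>s. s) f h)}"

text \<open>
  \<open>k\<close> is an integral kernel of the operator \<open>F(A) = \<integral> F(s) dE(s)\<close> on \<open>L\<^sup>2\<close>, for a positive
  self-adjoint operator \<open>A\<close> and bounded \<open>F\<close>, where \<open>E\<close> is the (unique) spectral resolution of \<open>A\<close>.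
\<close>

definition calculus_kernel ::
    "'a measure \<Rightarrow> 'a op_graph \<Rightarrow> (real \<Rightarrow> real) \<Rightarrow> ('a \<Rightarrow> 'a \<Rightarrow> complex) \<Rightarrow> bool" where
  "calculus_kernel \<mu> A F k \<longleftrightarrow>
     (\<lambda>(x, y). k x y) \<in> borel_measurable (\<mu> \<Otimes>\<^sub>M \<mu>) \<and>
     (\<exists>E. spectral_resolution \<mu> A E \<and>
        (\<forall>f \<in> L2 \<mu>.
           (AE x in \<mu>. integrable \<mu> (\<lambda>y. k x y * f y)) \<and>
           (\<lambda>x. LINT y|\<mu>. k x y * f y) \<in> L2 \<mu> \<and>
           (\<forall>h \<in> L2 \<mu>. L2_inner \<mu> (\<lambda>x. LINT y|\<mu>. k x y * f y) h = spectral_form \<mu> E F f h)))"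


section \<open>The setting\<close>

definition radon_measure :: "'a::metric_space measure \<Rightarrow> bool" where
  "radon_measure \<mu> \<longleftrightarrow>
     sets \<mu> = sets borel \<and>
     (\<forall>K. compact K \<longrightarrow> emeasure \<mu> K < \<infinity>) \<and>
     (\<forall>S \<in> sets \<mu>. emeasure \<mu> S = (INF U \<in> {U. open U \<and> S \<subseteq> U}. emeasure \<mu> U)) \<and>
     (\<forall>U. open U \<longrightarrow> emeasure \<mu> U = (SUP K \<in> {K. compact K \<and> K \<subseteq> U}. emeasure \<mu> K))"

text \<open>
  The metric space \<open>M\<close> is the type \<open>'a\<close>. In the reverse doubling condition \<open>diam M = \<infinity>\<close> must impose no
  restriction on \<open>r\<close>, but the real-valued \<^const>\<open>diameter\<close> is meaningless for unbounded sets.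
\<close>

locale heat_kernel_setting =
  fixes \<mu> :: "'a::metric_space measure"
    and L :: "'a op_graph"
    and hk :: "real \<Rightarrow> 'a \<Rightarrow> 'a \<Rightarrow> real"
    and d \<alpha> :: real
  assumes locally_compact: "locally compact (UNIV :: 'a set)"
    and radon: "radon_measure \<mu>"
    and d_pos: "0 < d"
    and doubling: "\<And>x r. 0 < r \<Longrightarrow>
          0 < emeasure \<mu> (ball x (2 * r)) \<and>
          emeasure \<mu> (ball x (2 * r)) \<le> ennreal (2 powr d) * emeasure \<mu> (ball x r) \<and>
          ennreal (2 powr d) * emeasure \<mu> (ball x r) < \<infinity>"
    and reverse_doubling: "\<exists>\<beta> > 0. \<forall>x r. 0 < r \<longrightarrow>
          (bounded (UNIV :: 'a set) \<longrightarrow> r \<le> diameter (UNIV :: 'a set) / 3) \<longrightarrow>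
          ennreal (2 powr \<beta>) * emeasure \<mu> (ball x r) \<le> emeasure \<mu> (ball x (2 * r))"
    and non_collapsing: "\<exists>c > 0. \<forall>x. c \<le> measure \<mu> (ball x 1)"
    and L_ess_self_adjoint: "essentially_self_adjoint \<mu> L"
    and L_positive: "positive_operator \<mu> L"
    and heat_kernel: "\<And>t. 0 < t \<Longrightarrow>
          calculus_kernel \<mu> (op_closure \<mu> L) (\<lambda>s. exp (- t * s)) (\<lambda>x y. complex_of_real (hk t x y))"
    and gaussian_bound: "\<exists>C > 0. \<exists>c > 0. \<forall>x y t. 0 < t \<longrightarrow> t \<le> 1 \<longrightarrow>
          hk t x y \<le> C * exp (- c * (dist x y)\<^sup>2 / t) /
            sqrt (measure \<mu> (ball x (sqrt t)) * measure \<mu> (ball y (sqrt t)))"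
    and alpha_pos: "0 < \<alpha>"
    and hoelder: "\<exists>C > 0. \<exists>c > 0. \<forall>x y y' t. 0 < t \<longrightarrow> t \<le> 1 \<longrightarrow> dist y y' \<le> sqrt t \<longrightarrow>
          \<bar>hk t x y - hk t x y'\<bar> \<le> C * (dist y y' / sqrt t) powr \<alpha> * exp (- c * (dist x y)\<^sup>2 / t) /
            sqrt (measure \<mu> (ball x (sqrt t)) * measure \<mu> (ball y (sqrt t)))"
    and markov: "\<And>t x. 0 < t \<Longrightarrow> has_bochner_integral \<mu> (\<lambda>y. hk t x y) 1"

definition D_kernel :: "'a::metric_space measure \<Rightarrow> real \<Rightarrow> real \<Rightarrow> 'a \<Rightarrow> 'a \<Rightarrow> real" where
  "D_kernel \<mu> \<delta> \<sigma> x y =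
     (measure \<mu> (ball x \<delta>) * measure \<mu> (ball y \<delta>)) powr (-1/2) * (1 + dist x y / \<delta>) powr (- \<sigma>)"

text \<open>\<open>C\<^sup>\<infinity>([0,\<infinity>))\<close>, with one-sided derivatives at \<open>0\<close>; values at negative arguments are irrelevant.\<close>

definition smooth_half_line :: "(real \<Rightarrow> real) \<Rightarrow> bool" where
  "smooth_half_line \<phi> \<longleftrightarrow>
     (\<exists>D :: nat \<Rightarrow> real \<Rightarrow> real. (\<forall>x \<ge> 0. D 0 x = \<phi> x) \<and>
        (\<forall>n. \<forall>x \<ge> 0. (D n has_real_derivative D (Suc n) x) (at x within {0..})))"

definition half_line_support :: "(real \<Rightarrow> real) \<Rightarrow> real set" where
  "half_line_support \<phi> = closure {x. 0 \<le> x \<and> \<phi> x \<noteq> 0}"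

definition cutoff_function :: "(real \<Rightarrow> real) \<Rightarrow> bool" where
  "cutoff_function \<phi> \<longleftrightarrow>
     smooth_half_line \<phi> \<and> (\<exists>b > 1. half_line_support \<phi> \<subseteq> {0..b}) \<and>
     (\<forall>x \<ge> 0. 0 \<le> \<phi> x \<and> \<phi> x \<le> 1) \<and> (\<forall>x \<in> {0..1}. \<phi> x = 1)"

text \<open>
  \<open>\<Sigma>\<^sub>\<lambda>\<^sup>p\<close>, whose elements are identified with their continuous representatives. The kernel of
  \<open>\<theta>(\<surd>L)\<close> is unique up to null sets, so its choice is immaterial.
\<close>

definition spectral_space ::
    "'a::metric_space measure \<Rightarrow> 'a op_graph \<Rightarrow> real \<Rightarrow> ennreal \<Rightarrow> ('a \<Rightarrow> complex) set" where
  "spectral_space \<mu> L lam p =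
     {f \<in> Lp_space \<mu> p. continuous_on UNIV f \<and>
        (\<forall>\<theta>. smooth_half_line \<theta> \<longrightarrow> compact (half_line_support \<theta>) \<longrightarrow> (\<forall>x \<in> {0..lam}. \<theta> x = 1) \<longrightarrow>
           (\<forall>k. calculus_kernel \<mu> (op_closure \<mu> L) (\<lambda>s. \<theta> (sqrt s)) k \<longrightarrow>
              (AE x in \<mu>. has_bochner_integral \<mu> (\<lambda>y. k x y * f y) (f x))))}"

definition delta_net :: "real \<Rightarrow> 'a::metric_space set \<Rightarrow> bool" where
  "delta_net \<delta> X \<longleftrightarrow> (\<forall>\<xi> \<in> X. \<forall>\<eta> \<in> X. \<xi> \<noteq> \<eta> \<longrightarrow> \<delta> \<le> dist \<xi> \<eta>)"

definition maximal_delta_net :: "real \<Rightarrow> 'a::metric_space set \<Rightarrow> bool" where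
  "maximal_delta_net \<delta> X \<longleftrightarrow> delta_net \<delta> X \<and> (\<forall>Y. delta_net \<delta> Y \<and> X \<subseteq> Y \<longrightarrow> Y = X)"

end

theory Submission
  imports Defs
begin

text \<open>
Put \<open>t = 1 / \<lambda>\<close>. A function \<open>f\<close> in the spectral space is reproduced by the kernel \<open>\<Phi>\<close> of \<open>\<phi>(t \<surd>L)\<close>, so for
\<open>x\<close> in the cell of the net point \<open>\<xi>\<^sub>x\<close> the difference \<open>f(x) - f(\<xi>\<^sub>x)\<close> is the integral of
\<open>(\<Phi>(x, y) - \<Phi>(\<xi>\<^sub>x, y)) f(y)\<close>. The net has mesh \<open>\<delta> = \<gamma> t\<close>, and the Hoelder bound therefore dominates the
kernel of this integral by \<open>K \<gamma>\<^sup>\<alpha> D(x, y)\<close>.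

The kernel \<open>D\<close> has mass at most \<open>2\<^bsup>2d+1\<^esup>\<close> in each variable (\<open>nn_integral_D_kernel_le\<close>), by doubling and a
dyadic decomposition. By Schur's test (\<open>schur_test_powr\<close>) the step function \<open>x \<mapsto> f(\<xi>\<^sub>x)\<close> is within
\<open>Q \<parallel>f\<parallel>\<^sub>p\<close> of \<open>f\<close>, where \<open>Q = K \<gamma>\<^sup>\<alpha> 2\<^bsup>2d+1\<^esup>\<close>. The \<open>p\<close>-th power of the norm of the step function is precisely
the sum \<open>\<Sum> |A\<^sub>\<xi>| |f(\<xi>)|\<^sup>p\<close>, so the \<open>p\<close>-th root of the sum lies between \<open>(1 - Q) \<parallel>f\<parallel>\<^sub>p\<close> and
\<open>(1 + Q) \<parallel>f\<parallel>\<^sub>p\<close> (\<open>sampling_Lp\<close>). The supremum norm is treated in the same way (\<open>sampling_sup\<close>).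
With \<open>Q \<le> 1/2\<close> these bounds give the factors \<open>1/2\<close> and \<open>2\<close>; with \<open>Q \<le> \<epsilon>/3\<close> and \<open>p \<le> 2\<close> they give
\<open>1 - \<epsilon>\<close> and \<open>1 + \<epsilon>\<close> for the \<open>p\<close>-th powers.

Point values make sense because the reproducing formula, which the functional calculus provides
almost everywhere, holds at every point for continuous \<open>f\<close> (\<open>reproducing_everywhere\<close>).
\<close>

section \<open>Jensen, Schur and Minkowski inequalities for real powers\<close>

text \<open>
This is Young's inequality for \<open>u \<cdot> 1\<close> with a free scale \<open>c\<close>, or equivalently the fact that
\<open>u \<mapsto> u\<^sup>p\<close> lies above its tangent at \<open>c\<close>. Being linear in \<open>u\<^sup>p\<close>, it can be integrated, and \<open>c\<close> can be
optimised after the integration.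
\<close>
lemma young_powr:
  fixes u c p :: real
  assumes p: "1 \<le> p" and u: "0 \<le> u" and c: "0 < c"
  shows "u \<le> u powr p * (c powr (1 - p) / p) + (1 - 1 / p) * c"
proof (cases "u = 0")
  case True
  with p c show ?thesis by simp
next
  case False
  with u have u': "0 < u" by simp
  have "(u powr p * c powr (1 - p)) powr (1 / p) * c powr (1 - 1 / p)
      \<le> 1 / p * (u powr p * c powr (1 - p)) + (1 - 1 / p) * c"
    using p u' c by (intro Youngs_inequality_0) auto
  moreover have "(u powr p * c powr (1 - p)) powr (1 / p) * c powr (1 - 1 / p) = u"
  proof -
    have e: "(1 - p) * (1 / p) + (1 - 1 / p) = 0" using p by (simp add: field_simps)
    have "(u powr p * c powr (1 - p)) powr (1 / p)
        = (u powr p) powr (1 / p) * (c powr (1 - p)) powr (1 / p)"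
      by (rule powr_mult)
    also have "\<dots> = u * c powr ((1 - p) * (1 / p))" using p u' by (simp add: powr_powr)
    finally have "(u powr p * c powr (1 - p)) powr (1 / p) * c powr (1 - 1 / p)
        = u * (c powr ((1 - p) * (1 / p)) * c powr (1 - 1 / p))" by simp
    also have "\<dots> = u * c powr 0" by (simp only: powr_add[symmetric] e)
    finally show ?thesis using c by simp
  qed
  ultimately show ?thesis by (simp add: field_simps)
qed

text \<open>
Jensen's inequality for a weight \<open>\<kappa>\<close> of total mass at most \<open>Q\<close>. Integrating
the tangent inequality against \<open>\<kappa>\<close> bounds \<open>h\<close> by a combination of the \<open>p\<close>-th moment \<open>g\<close> and \<open>Q\<close>; the scale
\<open>c = (g / Q)\<^bsup>1/p\<^esup>\<close> makes this \<open>c Q\<close>, whose \<open>p\<close>-th power is \<open>g Q\<^bsup>p-1\<^esup>\<close>.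
\<close>
lemma nn_integral_jensen_powr:
  fixes \<kappa> u :: "'a \<Rightarrow> real"
  assumes p: "1 \<le> p" and Q: "0 < Q"
    and \<kappa>[measurable]: "\<kappa> \<in> borel_measurable \<nu>" and \<kappa>0: "\<And>y. 0 \<le> \<kappa> y"
    and u[measurable]: "u \<in> borel_measurable \<nu>" and u0: "\<And>y. 0 \<le> u y"
    and mass: "(\<integral>\<^sup>+y. ennreal (\<kappa> y) \<partial>\<nu>) \<le> ennreal Q"
    and h0: "0 \<le> h" and h: "ennreal h \<le> (\<integral>\<^sup>+y. ennreal (\<kappa> y * u y) \<partial>\<nu>)"
  shows "ennreal (h powr p) \<le> ennreal (Q powr (p - 1)) * (\<integral>\<^sup>+y. ennreal (\<kappa> y * u y powr p) \<partial>\<nu>)"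
    (is "_ \<le> _ * ?G")
proof (cases "?G = \<infinity>")
  case True
  with Q show ?thesis by (simp add: ennreal_mult_top)
next
  case False
  then obtain g where g0: "0 \<le> g" and g: "?G = ennreal g"
    by (metis ennreal_cases infinity_ennreal_def)
  \<comment> \<open>The scale must be positive, so \<open>g\<close> is replaced by \<open>g + e\<close>; this covers \<open>g = 0\<close> as well.\<close>
  have "h powr p \<le> (g + e) * Q powr (p - 1)" if e: "0 < e" for e
  proof -
    define c where "c = ((g + e) / Q) powr (1 / p)"
    have c: "0 < c" using g0 e Q by (simp add: c_def)
    have cp: "c powr p = (g + e) / Q" using p g0 e Q by (simp add: c_def powr_powr)
    have "ennreal h \<le> (\<integral>\<^sup>+y. ennreal (\<kappa> y * u y) \<partial>\<nu>)" by (rule h)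
    also have "\<dots> \<le> (\<integral>\<^sup>+y. ennreal (c powr (1 - p) / p) * ennreal (\<kappa> y * u y powr p)
                    + ennreal ((1 - 1 / p) * c) * ennreal (\<kappa> y) \<partial>\<nu>)"
    proof (rule nn_integral_mono)
      fix y
      have "\<kappa> y * u y \<le> \<kappa> y * (u y powr p * (c powr (1 - p) / p) + (1 - 1 / p) * c)"
        by (intro mult_left_mono young_powr p u0 c \<kappa>0)
      also have "\<dots> = c powr (1 - p) / p * (\<kappa> y * u y powr p) + (1 - 1 / p) * c * \<kappa> y"
        by (simp add: algebra_simps)
      finally show "ennreal (\<kappa> y * u y) \<le> ennreal (c powr (1 - p) / p) * ennreal (\<kappa> y * u y powr p)
                    + ennreal ((1 - 1 / p) * c) * ennreal (\<kappa> y)"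
        using p c \<kappa>0[of y]
        by (simp add: ennreal_mult[symmetric] ennreal_plus[symmetric] del: ennreal_plus)
    qed
    also have "\<dots> = ennreal (c powr (1 - p) / p) * ennreal g
                    + ennreal ((1 - 1 / p) * c) * (\<integral>\<^sup>+y. ennreal (\<kappa> y) \<partial>\<nu>)"
      by (simp add: nn_integral_add nn_integral_cmult g)
    also have "\<dots> \<le> ennreal (c powr (1 - p) / p) * ennreal (g + e) + ennreal ((1 - 1 / p) * c) * ennreal Q"
      using e by (intro add_mono mult_left_mono mass ennreal_leI) auto
    also have "\<dots> = ennreal (c powr (1 - p) / p * (g + e) + (1 - 1 / p) * c * Q)"
      using p c Q g0 e
      by (simp add: ennreal_mult[symmetric] ennreal_plus[symmetric] del: ennreal_plus)
    finally have "h \<le> c powr (1 - p) / p * (g + e) + (1 - 1 / p) * c * Q"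
      using p c Q g0 e by (subst (asm) ennreal_le_iff) auto
    also have "c powr (1 - p) * (g + e) = c * Q"
    proof -
      have "c powr (1 - p) * c powr p = c"
        using c by (simp flip: powr_add)
      then show ?thesis using cp Q c by (simp add: field_simps)
    qed
    then have "c powr (1 - p) / p * (g + e) + (1 - 1 / p) * c * Q = c * Q"
      using p by (simp add: field_simps)
    finally have "h powr p \<le> (c * Q) powr p"
      using h0 p by (intro powr_mono2) auto
    also have "\<dots> = (g + e) * Q powr (p - 1)"
      using c Q by (simp add: powr_mult cp powr_diff)
    finally show ?thesis .
  qed
  then have "h powr p \<le> g * Q powr (p - 1) + x" if "0 < x" for x
    using Q that by (metis distrib_right divide_pos_pos less_numeral_extra(3) nonzero_eq_divide_eq powr_gt_zero)
  then have "h powr p \<le> g * Q powr (p - 1)" by (rule field_le_epsilon)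
  then show ?thesis
    by (simp add: g ennreal_mult[symmetric] g0 mult.commute)
qed

text \<open>
Schur's test: the bound on the rows of \<open>k\<close> enters through Jensen's inequality and contributes
\<open>Q\<^bsup>p-1\<^esup>\<close>; the bound on the columns enters after exchanging the integrals and contributes \<open>Q\<close>.
\<close>
lemma schur_test_powr:
  fixes k :: "'a \<Rightarrow> 'a \<Rightarrow> real" and u h :: "'a \<Rightarrow> real"
  assumes sf: "sigma_finite_measure \<mu>" and p: "1 \<le> p" and Q: "0 < Q"
    and k[measurable]: "(\<lambda>(x, y). k x y) \<in> borel_measurable (\<mu> \<Otimes>\<^sub>M \<mu>)" and k0: "\<And>x y. 0 \<le> k x y"
    and row: "\<And>x. x \<in> space \<mu> \<Longrightarrow> (\<integral>\<^sup>+y. ennreal (k x y) \<partial>\<mu>) \<le> ennreal Q"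
    and col: "\<And>y. y \<in> space \<mu> \<Longrightarrow> (\<integral>\<^sup>+x. ennreal (k x y) \<partial>\<mu>) \<le> ennreal Q"
    and u[measurable]: "u \<in> borel_measurable \<mu>" and u0: "\<And>y. 0 \<le> u y"
    and h0: "\<And>x. 0 \<le> h x"
    and h: "\<And>x. x \<in> space \<mu> \<Longrightarrow> ennreal (h x) \<le> (\<integral>\<^sup>+y. ennreal (k x y * u y) \<partial>\<mu>)"
  shows "(\<integral>\<^sup>+x. ennreal (h x powr p) \<partial>\<mu>) \<le> ennreal (Q powr p) * (\<integral>\<^sup>+x. ennreal (u x powr p) \<partial>\<mu>)"
proof -
  interpret sigma_finite_measure \<mu> by (rule sf)
  interpret pair_sigma_finite \<mu> \<mu> ..
  have kx[measurable]: "(\<lambda>y. k x y) \<in> borel_measurable \<mu>" if "x \<in> space \<mu>" for x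
    using measurable_Pair2[OF k that] by simp
  have ky[measurable]: "(\<lambda>x. k x y) \<in> borel_measurable \<mu>" if "y \<in> space \<mu>" for y
    using measurable_Pair1[OF k that] by simp
  have "(\<integral>\<^sup>+x. ennreal (h x powr p) \<partial>\<mu>)
      \<le> (\<integral>\<^sup>+x. ennreal (Q powr (p - 1)) * (\<integral>\<^sup>+y. ennreal (k x y * u y powr p) \<partial>\<mu>) \<partial>\<mu>)"
    by (intro nn_integral_mono nn_integral_jensen_powr p Q k0 u u0 h0 row h kx)
  also have "\<dots> = ennreal (Q powr (p - 1)) * (\<integral>\<^sup>+x. \<integral>\<^sup>+y. ennreal (k x y * u y powr p) \<partial>\<mu> \<partial>\<mu>)"
    by (rule nn_integral_cmult) measurable
  also have "(\<integral>\<^sup>+x. \<integral>\<^sup>+y. ennreal (k x y * u y powr p) \<partial>\<mu> \<partial>\<mu>)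
      = (\<integral>\<^sup>+y. \<integral>\<^sup>+x. ennreal (k x y * u y powr p) \<partial>\<mu> \<partial>\<mu>)"
    by (rule Fubini'[symmetric]) measurable
  also have "\<dots> \<le> (\<integral>\<^sup>+y. ennreal Q * ennreal (u y powr p) \<partial>\<mu>)"
  proof (rule nn_integral_mono)
    fix y assume y: "y \<in> space \<mu>"
    have "(\<integral>\<^sup>+x. ennreal (k x y * u y powr p) \<partial>\<mu>)
        = (\<integral>\<^sup>+x. ennreal (k x y) \<partial>\<mu>) * ennreal (u y powr p)"
      using y by (simp add: ennreal_mult k0 nn_integral_multc)
    also have "\<dots> \<le> ennreal Q * ennreal (u y powr p)"
      by (intro mult_right_mono col y) auto
    finally show "(\<integral>\<^sup>+x. ennreal (k x y * u y powr p) \<partial>\<mu>) \<le> ennreal Q * ennreal (u y powr p)" .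
  qed
  also have "\<dots> = ennreal Q * (\<integral>\<^sup>+y. ennreal (u y powr p) \<partial>\<mu>)"
    by (rule nn_integral_cmult) measurable
  also have "ennreal (Q powr (p - 1)) * (ennreal Q * (\<integral>\<^sup>+y. ennreal (u y powr p) \<partial>\<mu>))
      = ennreal (Q powr p) * (\<integral>\<^sup>+y. ennreal (u y powr p) \<partial>\<mu>)"
  proof -
    have "Q powr (p - 1) * Q = Q powr p" using Q by (simp add: powr_diff)
    then show ?thesis using Q by (simp add: mult.assoc[symmetric] ennreal_mult[symmetric])
  qed
  finally show ?thesis by (simp add: mult_left_mono)
qed

text \<open>
Convexity of \<open>z \<mapsto> z\<^sup>p\<close> at \<open>a + b = (1 - \<theta>) (a / (1 - \<theta>)) + \<theta> (b / \<theta>)\<close>. A suitable constant \<open>\<theta>\<close> turns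
this pointwise inequality, once integrated, into Minkowski's inequality with its sharp constant.
\<close>
lemma powr_add_le_weighted:
  fixes a b p \<theta> :: real
  assumes p: "1 \<le> p" and a: "0 \<le> a" and b: "0 \<le> b" and \<theta>: "0 < \<theta>" "\<theta> < 1"
  shows "(a + b) powr p \<le> (1 - \<theta>) powr (1 - p) * a powr p + \<theta> powr (1 - p) * b powr p"
proof -
  have ge1: "1 \<le> s powr (1 - p)" if "0 < s" "s < 1" for s :: real
    using powr_mono'[of "1 - p" 0 s] p that by simp
  consider "a = 0" | "b = 0" | "0 < a" "0 < b" using a b by linarith
  then show ?thesis
  proof cases
    case 1
    then show ?thesis using mult_right_mono[OF ge1[OF \<theta>], of "b powr p"] by simp
  next
    case 2
    then show ?thesis using mult_right_mono[OF ge1[of "1 - \<theta>"], of "a powr p"] \<theta> by simp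
  next
    case 3
    have split: "s * (z / s) powr p = s powr (1 - p) * z powr p" if "0 < s" "0 < z" for s z :: real
      using that by (simp add: powr_divide powr_diff)
    have "((1 - \<theta>) * (a / (1 - \<theta>)) + \<theta> * (b / \<theta>)) powr p
        \<le> (1 - \<theta>) * (a / (1 - \<theta>)) powr p + \<theta> * (b / \<theta>) powr p"
      using convex_onD[OF powr_convex[OF p], of \<theta> "a / (1 - \<theta>)" "b / \<theta>"] 3 \<theta> by simp
    then show ?thesis using 3 \<theta> by (simp add: split)
  qed
qed

text \<open>
Minkowski's inequality for \<open>|f - s| \<le> h\<close>, raised to the power \<open>p\<close>. Because the bound \<open>Q\<close> on the ratio of
the norms of \<open>h\<close> and \<open>f\<close> is known in advance, the weighted splitting of \<open>(a + b)\<^sup>p\<close> can be used with the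
optimal weight, namely \<open>\<theta> = Q\<close> for the lower bound and \<open>\<theta> = Q / (1 + Q)\<close> for the upper one. The integral of
\<open>s\<^sup>p\<close> is allowed to be infinite a priori: its finiteness is part of the conclusion.
\<close>
lemma nn_integral_powr_perturbation:
  fixes f s h :: "'a \<Rightarrow> real"
  assumes p: "1 \<le> p" and Q: "0 < Q" "Q < 1"
    and [measurable]: "f \<in> borel_measurable \<mu>" "s \<in> borel_measurable \<mu>" "h \<in> borel_measurable \<mu>"
    and f0: "\<And>x. 0 \<le> f x" and s0: "\<And>x. 0 \<le> s x" and h0: "\<And>x. 0 \<le> h x"
    and f_le: "\<And>x. f x \<le> s x + h x" and s_le: "\<And>x. s x \<le> f x + h x"
    and F: "(\<integral>\<^sup>+x. ennreal (f x powr p) \<partial>\<mu>) = ennreal F" and F0: "0 \<le> F"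
    and h: "(\<integral>\<^sup>+x. ennreal (h x powr p) \<partial>\<mu>) \<le> ennreal (Q powr p) * ennreal F"
  shows "ennreal ((1 - Q) powr p * F) \<le> (\<integral>\<^sup>+x. ennreal (s x powr p) \<partial>\<mu>)"
    and "(\<integral>\<^sup>+x. ennreal (s x powr p) \<partial>\<mu>) \<le> ennreal ((1 + Q) powr p * F)"
proof -
  have split: "(\<integral>\<^sup>+x. ennreal (g x powr p) \<partial>\<mu>)
      \<le> ennreal ((1 - \<theta>) powr (1 - p)) * (\<integral>\<^sup>+x. ennreal (g' x powr p) \<partial>\<mu>)
         + ennreal (\<theta> powr (1 - p) * (Q powr p * F))"
    if [measurable]: "g' \<in> borel_measurable \<mu>" and g0: "\<And>x. 0 \<le> g x" and g'0: "\<And>x. 0 \<le> g' x"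
      and le: "\<And>x. g x \<le> g' x + h x" and \<theta>: "0 < \<theta>" "\<theta> < 1" for g g' :: "'a \<Rightarrow> real" and \<theta>
  proof -
    have "(\<integral>\<^sup>+x. ennreal (g x powr p) \<partial>\<mu>)
       \<le> (\<integral>\<^sup>+x. ennreal ((1 - \<theta>) powr (1 - p)) * ennreal (g' x powr p)
             + ennreal (\<theta> powr (1 - p)) * ennreal (h x powr p) \<partial>\<mu>)"
    proof (rule nn_integral_mono)
      fix x
      have "g x powr p \<le> (g' x + h x) powr p"
        using p g0 le by (intro powr_mono2) auto
      also have "\<dots> \<le> (1 - \<theta>) powr (1 - p) * g' x powr p + \<theta> powr (1 - p) * h x powr p"
        by (rule powr_add_le_weighted[OF p g'0 h0 \<theta>])
      finally show "ennreal (g x powr p) \<le> ennreal ((1 - \<theta>) powr (1 - p)) * ennreal (g' x powr p)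
             + ennreal (\<theta> powr (1 - p)) * ennreal (h x powr p)"
        by (simp add: ennreal_mult[symmetric] ennreal_plus[symmetric] del: ennreal_plus)
    qed
    also have "\<dots> = ennreal ((1 - \<theta>) powr (1 - p)) * (\<integral>\<^sup>+x. ennreal (g' x powr p) \<partial>\<mu>)
             + ennreal (\<theta> powr (1 - p)) * (\<integral>\<^sup>+x. ennreal (h x powr p) \<partial>\<mu>)"
      by (simp add: nn_integral_add nn_integral_cmult)
    also have "\<dots> \<le> ennreal ((1 - \<theta>) powr (1 - p)) * (\<integral>\<^sup>+x. ennreal (g' x powr p) \<partial>\<mu>)
             + ennreal (\<theta> powr (1 - p)) * (ennreal (Q powr p) * ennreal F)"
      by (intro add_left_mono mult_left_mono h) simp
    finally show ?thesis using F0 by (simp add: ennreal_mult)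
  qed
  have QQ: "Q powr (1 - p) * Q powr p = Q" using Q by (simp flip: powr_add)
  show "ennreal ((1 - Q) powr p * F) \<le> (\<integral>\<^sup>+x. ennreal (s x powr p) \<partial>\<mu>)" (is "_ \<le> ?S")
  proof (cases "?S = \<infinity>")
    case True
    then show ?thesis by simp
  next
    case False
    then obtain S where S0: "0 \<le> S" and S: "?S = ennreal S"
      by (metis ennreal_cases infinity_ennreal_def)
    have "ennreal F \<le> ennreal ((1 - Q) powr (1 - p)) * ennreal S
         + ennreal (Q powr (1 - p) * (Q powr p * F))"
      using split[of s f Q] f0 s0 f_le Q by (simp add: F S)
    then have "F \<le> (1 - Q) powr (1 - p) * S + Q powr (1 - p) * (Q powr p * F)"
      using S0 F0
      by (simp add: ennreal_mult[symmetric] ennreal_plus[symmetric] del: ennreal_plus)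
    moreover have "Q powr (1 - p) * (Q powr p * F) = Q * F"
      by (simp only: mult.assoc[symmetric] QQ)
    ultimately have "(1 - Q) * F \<le> (1 - Q) powr (1 - p) * S"
      by (simp add: left_diff_distrib)
    then have "(1 - Q) powr (p - 1) * ((1 - Q) * F) \<le> (1 - Q) powr (p - 1) * ((1 - Q) powr (1 - p) * S)"
      by (rule mult_left_mono) simp
    moreover have "(1 - Q) powr (p - 1) * (1 - Q) = (1 - Q) powr p"
      using Q by (simp add: powr_diff)
    moreover have "(1 - Q) powr (p - 1) * (1 - Q) powr (1 - p) = 1"
      using Q by (simp flip: powr_add)
    ultimately have "(1 - Q) powr p * F \<le> S" by (simp add: mult.assoc[symmetric])
    then show ?thesis by (simp add: S ennreal_leI)
  qed
  define \<theta> where "\<theta> = Q / (1 + Q)"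
  have \<theta>: "0 < \<theta>" "\<theta> < 1" "1 - \<theta> = inverse (1 + Q)" using Q by (auto simp: \<theta>_def field_simps)
  have "?S \<le> ennreal ((1 - \<theta>) powr (1 - p)) * ennreal F + ennreal (\<theta> powr (1 - p) * (Q powr p * F))"
    using split[of f s \<theta>] f0 s0 s_le \<theta> by (simp add: F)
  also have "\<dots> = ennreal (((1 - \<theta>) powr (1 - p) + \<theta> powr (1 - p) * Q powr p) * F)"
    using F0 by (simp add: ennreal_mult[symmetric] ennreal_plus[symmetric] algebra_simps del: ennreal_plus)
  also have "(1 - \<theta>) powr (1 - p) + \<theta> powr (1 - p) * Q powr p = (1 + Q) powr p"
  proof -
    have 1: "(1 - \<theta>) powr (1 - p) = (1 + Q) powr (p - 1)"
      using Q by (simp add: \<theta>(3) powr_minus[symmetric] inverse_powr)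
    have "\<theta> powr (1 - p) = Q powr (1 - p) * (1 + Q) powr (p - 1)"
      using Q by (simp add: \<theta>_def powr_divide powr_diff field_simps)
    then have "\<theta> powr (1 - p) * Q powr p = Q * (1 + Q) powr (p - 1)"
      using QQ by (simp add: mult.commute mult.left_commute)
    then have "(1 - \<theta>) powr (1 - p) + \<theta> powr (1 - p) * Q powr p = (1 + Q) * (1 + Q) powr (p - 1)"
      by (simp add: 1 algebra_simps)
    also have "\<dots> = (1 + Q) powr p" using Q by (simp add: powr_diff)
    finally show ?thesis .
  qed
  finally show "(\<integral>\<^sup>+x. ennreal (s x powr p) \<partial>\<mu>) \<le> ennreal ((1 + Q) powr p * F)" .
qed

section \<open>Doubling measures and the kernel D\<close>

lemma dyadic_bracket:
  fixes w :: real
  assumes w: "1 \<le> w"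
  shows "\<exists>j. 2 ^ j \<le> w \<and> w < 2 ^ (j + 1)"
proof -
  define j where "j = (LEAST j. w < 2 ^ (j + 1))"
  have "\<exists>j. w < 2 ^ (j + 1)"
    using real_arch_pow[of 2 w] by (metis add.commute less_trans one_less_numeral_iff plus_1_eq_Suc power_strict_increasing_iff lessI semiring_norm(76))
  then have "w < 2 ^ (j + 1)" unfolding j_def by (rule LeastI_ex)
  moreover have "2 ^ j \<le> w"
  proof (cases j)
    case 0
    with w show ?thesis by simp
  next
    case (Suc m)
    then have "\<not> w < 2 ^ (m + 1)" using not_less_Least[of m "\<lambda>j. w < 2 ^ (j + 1)"] by (simp add: j_def)
    with Suc show ?thesis by simp
  qed
  ultimately show ?thesis by blast
qed

text \<open>
Isolates volume doubling, so that the constants in the kernel estimates are explicit in the exponent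
\<open>d\<close> alone.
\<close>

locale doubling_measure =
  fixes \<mu> :: "'a::metric_space measure" and d :: real
  assumes sets_eq_borel: "sets \<mu> = sets borel"
    and d_pos: "0 < d"
    and doubling: "\<And>x r. 0 < r \<Longrightarrow>
          0 < emeasure \<mu> (ball x (2 * r)) \<and>
          emeasure \<mu> (ball x (2 * r)) \<le> ennreal (2 powr d) * emeasure \<mu> (ball x r) \<and>
          ennreal (2 powr d) * emeasure \<mu> (ball x r) < \<infinity>"
begin

lemma space_eq_UNIV: "space \<mu> = UNIV"
  using sets_eq_imp_space_eq[OF sets_eq_borel] by simp

lemma borel_measurable_continuous: "continuous_on UNIV f \<Longrightarrow> f \<in> borel_measurable \<mu>"
  for f :: "'a \<Rightarrow> 'b::topological_space"
  using borel_measurable_continuous_onI measurable_cong_sets[OF sets_eq_borel refl] by blast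

lemma measurable_dist: "dist x \<in> borel_measurable \<mu>"
  by (intro borel_measurable_continuous continuous_intros)

lemma ball_sets: "ball x r \<in> sets \<mu>"
  by (simp add: sets_eq_borel)

lemma emeasure_ball_pos: "0 < r \<Longrightarrow> 0 < emeasure \<mu> (ball x r)"
  using doubling[of "r / 2" x] by simp

lemma emeasure_ball_finite: "0 < r \<Longrightarrow> emeasure \<mu> (ball x r) < \<infinity>"
  using doubling[of "r / 2" x] by auto

lemma emeasure_ball: "0 < r \<Longrightarrow> emeasure \<mu> (ball x r) = ennreal (measure \<mu> (ball x r))"
  using emeasure_ball_finite[of r x] by (intro emeasure_eq_ennreal_measure) auto

lemma measure_ball_pos: "0 < r \<Longrightarrow> 0 < measure \<mu> (ball x r)"
  using emeasure_ball_pos[of r x] emeasure_ball[of r x] by simp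

lemma measure_ball_mono: "0 < s \<Longrightarrow> ball x r \<subseteq> ball y s \<Longrightarrow> measure \<mu> (ball x r) \<le> measure \<mu> (ball y s)"
  using emeasure_ball_finite[of s y] ball_sets by (intro measure_mono_fmeasurable) (auto simp: fmeasurable_def)

lemma measure_ball_double: "0 < r \<Longrightarrow> measure \<mu> (ball x (2 * r)) \<le> 2 powr d * measure \<mu> (ball x r)"
  using doubling[of r x]
  by (simp add: emeasure_ball ennreal_mult[symmetric] ennreal_le_iff)

lemma measure_ball_double_power:
  assumes "0 < r"
  shows "measure \<mu> (ball x (2 ^ n * r)) \<le> (2 ^ n) powr d * measure \<mu> (ball x r)"
proof (induction n)
  case (Suc n)
  have "measure \<mu> (ball x (2 * (2 ^ n * r))) \<le> 2 powr d * measure \<mu> (ball x (2 ^ n * r))"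
    using assms by (intro measure_ball_double) simp
  also have "\<dots> \<le> 2 powr d * ((2 ^ n) powr d * measure \<mu> (ball x r))"
    by (intro mult_left_mono Suc) simp
  finally show ?case by (simp add: powr_mult mult.assoc)
qed simp

text \<open>
The factor \<open>2\<close> in \<open>(2 R)\<^sup>d\<close> is the price for rounding \<open>R\<close> up to a power of two.
\<close>
lemma measure_ball_growth:
  assumes r: "0 < r" and R: "1 \<le> R"
  shows "measure \<mu> (ball x (R * r)) \<le> (2 * R) powr d * measure \<mu> (ball x r)"
proof -
  obtain j where j: "2 ^ j \<le> R" "R < 2 ^ (j + 1)" using dyadic_bracket[OF R] by blast
  define n where "n = j + 1"
  have n: "R \<le> 2 ^ n" "2 ^ n \<le> 2 * R" using j by (auto simp: n_def)
  have "measure \<mu> (ball x (R * r)) \<le> measure \<mu> (ball x (2 ^ n * r))"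
    using n(1) r by (intro measure_ball_mono subset_ball) auto
  also have "\<dots> \<le> (2 ^ n) powr d * measure \<mu> (ball x r)"
    by (rule measure_ball_double_power[OF r])
  also have "\<dots> \<le> (2 * R) powr d * measure \<mu> (ball x r)"
    using n(2) d_pos by (intro mult_right_mono powr_mono2) auto
  finally show ?thesis .
qed

text \<open>
\<open>B(x, t)\<close> lies in the ball about \<open>y\<close> of radius \<open>t + \<rho>(x, y)\<close>, which is a dilate of \<open>B(y, t)\<close>.
\<close>
lemma measure_ball_change_centre:
  assumes t: "0 < t"
  shows "measure \<mu> (ball x t) \<le> (2 * (1 + dist x y / t)) powr d * measure \<mu> (ball y t)"
proof -
  have "(1 + dist x y / t) * t = t + dist x y" using t by (simp add: field_simps)
  moreover have "ball x t \<subseteq> ball y (t + dist x y)"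
  proof
    fix z assume "z \<in> ball x t"
    with dist_triangle[of y z x] show "z \<in> ball y (t + dist x y)" by (simp add: dist_commute)
  qed
  ultimately have "measure \<mu> (ball x t) \<le> measure \<mu> (ball y ((1 + dist x y / t) * t))"
    using t by (intro measure_ball_mono) (auto simp: add_pos_nonneg)
  also have "\<dots> \<le> (2 * (1 + dist x y / t)) powr d * measure \<mu> (ball y t)"
    using t by (intro measure_ball_growth) auto
  finally show ?thesis .
qed

lemma sigma_finite: "sigma_finite_measure \<mu>"
proof
  have "(\<Union>n::nat. ball (undefined::'a) (real (Suc n))) = UNIV"
  proof (intro set_eqI iffI UNIV_I)
    fix x :: 'a
    obtain n :: nat where "dist undefined x < real n" using reals_Archimedean2 by blast
    then have "x \<in> ball undefined (real (Suc n))" by simp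
    then show "x \<in> (\<Union>n::nat. ball undefined (real (Suc n)))" by blast
  qed
  moreover have "emeasure \<mu> (ball undefined (real (Suc n))) \<noteq> \<infinity>" for n
    using emeasure_ball_finite[of "real (Suc n)" undefined] by simp
  ultimately show "\<exists>A. countable A \<and> A \<subseteq> sets \<mu> \<and> \<Union> A = space \<mu> \<and> (\<forall>a\<in>A. emeasure \<mu> a \<noteq> \<infinity>)"
    by (intro exI[of _ "range (\<lambda>n. ball undefined (real (Suc n)))"])
      (auto simp: ball_sets space_eq_UNIV)
qed

text \<open>
A null set contains no ball. This is what turns the almost everywhere identities of the functional
calculus into pointwise ones, so that \<open>f\<close> may be evaluated at the points of a net.
\<close>
lemma AE_eq_continuous_imp_eq:
  fixes f g :: "'a \<Rightarrow> 'b::t2_space"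
  assumes "continuous_on UNIV f" "continuous_on UNIV g" and ae: "AE x in \<mu>. f x = g x"
  shows "f x = g x"
proof (rule ccontr)
  assume ne: "f x \<noteq> g x"
  have "open {x. f x \<noteq> g x}" by (rule open_Collect_neq) (use assms in auto)
  with ne obtain e where e: "0 < e" "ball x e \<subseteq> {x. f x \<noteq> g x}"
    unfolding open_contains_ball by blast
  from ae obtain N where N: "{z \<in> space \<mu>. f z \<noteq> g z} \<subseteq> N" "emeasure \<mu> N = 0" "N \<in> sets \<mu>"
    by (auto elim: AE_E)
  have "ball x e \<subseteq> N" using e N by (auto simp: space_eq_UNIV)
  then have "emeasure \<mu> (ball x e) \<le> emeasure \<mu> N" using N by (intro emeasure_mono)
  with N emeasure_ball_pos[OF e(1), of x] show False by simp
qed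

text \<open>
On the dyadic shell \<open>2\<^sup>j \<le> 1 + \<rho>(x, y) / t < 2\<^bsup>j+1\<^esup>\<close> the integrand is at most \<open>2\<^bsup>-j(d+1)\<^esup>\<close>, while
doubling bounds the volume of the shell by \<open>2\<^bsup>(j+1)d\<^esup> |B(x, t)|\<close>. The shells thus contribute a
geometric series of ratio \<open>1/2\<close>, with sum \<open>2 \<cdot> 2\<^sup>d |B(x, t)|\<close>.
\<close>
lemma nn_integral_decay_le:
  assumes t: "0 < t"
  shows "(\<integral>\<^sup>+y. ennreal ((1 + dist x y / t) powr (- (d + 1))) \<partial>\<mu>)
    \<le> ennreal (2 powr (d + 1) * measure \<mu> (ball x t))"
proof -
  define a where "a j = (2 ^ j :: real) powr (- (d + 1))" for j :: nat
  define B where "B j = ball x (2 ^ (j + 1) * t)" for j :: nat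
  let ?m = "measure \<mu> (ball x t)"
  have [measurable]: "B j \<in> sets \<mu>" for j by (simp add: B_def ball_sets)
  have "(\<integral>\<^sup>+y. ennreal ((1 + dist x y / t) powr (- (d + 1))) \<partial>\<mu>)
      \<le> (\<integral>\<^sup>+y. (\<Sum>j. ennreal (a j) * indicator (B j) y) \<partial>\<mu>)"
  proof (rule nn_integral_mono)
    fix y
    obtain j where j: "2 ^ j \<le> 1 + dist x y / t" "1 + dist x y / t < 2 ^ (j + 1)"
      using dyadic_bracket[of "1 + dist x y / t"] t by auto
    then have le_a: "(1 + dist x y / t) powr (- (d + 1)) \<le> a j"
      unfolding a_def using d_pos by (intro powr_mono2') auto
    have "dist x y / t < 2 ^ (j + 1)" using j(2) by linarith
    then have "y \<in> B j" using t by (simp add: B_def field_simps)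
    then have "ennreal ((1 + dist x y / t) powr (- (d + 1))) \<le> ennreal (a j) * indicator (B j) y"
      using le_a by (simp add: ennreal_leI)
    also have "\<dots> \<le> (\<Sum>j. ennreal (a j) * indicator (B j) y)"
      using sum_le_suminf[of "\<lambda>j. ennreal (a j) * indicator (B j) y" "{j}"]
      by (simp del: sum_mult_indicator)
    finally show "ennreal ((1 + dist x y / t) powr (- (d + 1))) \<le> (\<Sum>j. ennreal (a j) * indicator (B j) y)" .
  qed
  also have "\<dots> = (\<Sum>j. ennreal (a j) * emeasure \<mu> (B j))"
    by (subst nn_integral_suminf) (auto simp: nn_integral_cmult_indicator)
  also have "\<dots> \<le> (\<Sum>j. ennreal (2 powr d * ?m * (1 / 2) ^ j))"
  proof (intro suminf_le allI summableI)
    fix j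
    have "a j * measure \<mu> (B j) \<le> a j * ((2 ^ (j + 1)) powr d * ?m)"
      unfolding B_def a_def using t by (intro mult_left_mono measure_ball_double_power) auto
    also have "\<dots> = 2 powr d * ?m * (a j * (2 ^ j) powr d)"
      by (simp add: powr_mult)
    also have "a j * (2 ^ j) powr d = (2 ^ j) powr (- 1)"
      by (simp add: a_def flip: powr_add)
    also have "\<dots> = (1 / 2) ^ j"
      by (simp add: powr_minus_divide power_one_over)
    finally have "a j * measure \<mu> (B j) \<le> 2 powr d * ?m * (1 / 2) ^ j" .
    moreover have "0 \<le> a j" by (simp add: a_def)
    ultimately show "ennreal (a j) * emeasure \<mu> (B j) \<le> ennreal (2 powr d * ?m * (1 / 2) ^ j)"
      unfolding B_def using t by (simp add: emeasure_ball ennreal_mult[symmetric] ennreal_leI)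
  qed
  also have "\<dots> = ennreal (2 powr d * ?m * 2)"
  proof (rule suminf_ennreal_eq)
    have "(\<lambda>j. (1 / 2 :: real) ^ j) sums 2" using geometric_sums[of "1 / 2 :: real"] by simp
    then show "(\<lambda>j. 2 powr d * ?m * (1 / 2) ^ j) sums (2 powr d * ?m * 2)"
      by (rule sums_mult)
  qed simp
  also have "2 powr d * ?m * 2 = 2 powr (d + 1) * ?m" by (simp add: powr_add)
  finally show ?thesis .
qed

lemma D_kernel_commute: "D_kernel \<mu> t \<sigma> x y = D_kernel \<mu> t \<sigma> y x"
  by (simp add: D_kernel_def dist_commute mult.commute)

lemma D_kernel_nonneg: "0 \<le> D_kernel \<mu> t \<sigma> x y"
  by (simp add: D_kernel_def)

text \<open>
Removes the volume at \<open>y\<close> from the kernel: comparing \<open>|B(y, t)|\<close> with \<open>|B(x, t)|\<close> under the square root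
costs \<open>(2 (1 + \<rho> / t))\<^bsup>d/2\<^esup>\<close>, which is relaxed to the power \<open>d\<close>. The exponent \<open>2 d + 1\<close> of the kernel leaves
exactly the decay \<open>d + 1\<close> that \<open>nn_integral_decay_le\<close> requires.
\<close>
lemma D_kernel_le:
  assumes t: "0 < t"
  shows "D_kernel \<mu> t (2 * d + 1) x y
    \<le> 2 powr d / measure \<mu> (ball x t) * (1 + dist x y / t) powr (- (d + 1))"
proof -
  define w where "w = 1 + dist x y / t"
  define m where "m = measure \<mu> (ball x t)"
  define m' where "m' = measure \<mu> (ball y t)"
  have w: "1 \<le> w" using t by (simp add: w_def)
  have m: "0 < m" "0 < m'" using measure_ball_pos[OF t] by (auto simp: m_def m'_def)
  have "m \<le> (2 * w) powr d * m'"
    using measure_ball_change_centre[OF t] by (simp add: w_def m_def m'_def)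
  also have "\<dots> \<le> (2 * w) powr (2 * d) * m'"
    using w d_pos m by (intro mult_right_mono powr_mono) auto
  finally have "m * m \<le> m * ((2 * w) powr (2 * d) * m')"
    using m by (intro mult_left_mono) auto
  then have "m\<^sup>2 / (2 * w) powr (2 * d) \<le> m * m'"
    using w by (simp add: divide_le_eq power2_eq_square mult_ac)
  then have "(m * m') powr (- 1 / 2) \<le> (m\<^sup>2 / (2 * w) powr (2 * d)) powr (- 1 / 2)"
    using m w by (intro powr_mono2') auto
  also have "m\<^sup>2 / (2 * w) powr (2 * d) = (m / (2 * w) powr d) powr 2"
    using m w by (simp add: power_divide power2_eq_square flip: powr_add)
  also have "\<dots> powr (- 1 / 2) = (2 * w) powr d / m"
    using m w by (simp add: powr_powr powr_minus_divide)
  finally have "(m * m') powr (- 1 / 2) * w powr (- (2 * d + 1)) \<le> (2 * w) powr d / m * w powr (- (2 * d + 1))"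
    by (rule mult_right_mono) simp
  also have "\<dots> = 2 powr d / m * (w powr d * w powr (- (2 * d + 1)))"
    by (simp add: powr_mult)
  also have "w powr d * w powr (- (2 * d + 1)) = w powr (- (d + 1))"
    by (simp only: powr_add[symmetric]) simp
  finally show ?thesis by (simp add: D_kernel_def w_def m_def m'_def)
qed

text \<open>
The constant is \<open>2\<^sup>d\<close> from the comparison of volumes times \<open>2\<^bsup>d+1\<^esup>\<close> from the dyadic sum. The function \<open>g\<close>
stands for the rows and the columns of a kernel that \<open>D\<close> dominates.
\<close>
lemma nn_integral_D_kernel_le:
  assumes t: "0 < t" and c: "0 \<le> c" and g: "\<And>y. g y \<le> c * D_kernel \<mu> t (2 * d + 1) x y"
  shows "(\<integral>\<^sup>+y. ennreal (g y) \<partial>\<mu>) \<le> ennreal (c * 2 powr (2 * d + 1))"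
proof -
  let ?m = "measure \<mu> (ball x t)"
  have m: "0 < ?m" by (rule measure_ball_pos[OF t])
  have [measurable]: "dist x \<in> borel_measurable \<mu>" by (rule measurable_dist)
  have "(\<integral>\<^sup>+y. ennreal (g y) \<partial>\<mu>)
     \<le> (\<integral>\<^sup>+y. ennreal (c * 2 powr d / ?m) * ennreal ((1 + dist x y / t) powr (- (d + 1))) \<partial>\<mu>)"
  proof (rule nn_integral_mono)
    fix y
    have "g y \<le> c * (2 powr d / ?m * (1 + dist x y / t) powr (- (d + 1)))"
      by (intro order_trans[OF g] mult_left_mono D_kernel_le t c)
    then show "ennreal (g y) \<le> ennreal (c * 2 powr d / ?m) * ennreal ((1 + dist x y / t) powr (- (d + 1)))"
      using c by (simp add: ennreal_mult[symmetric] ennreal_leI)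
  qed
  also have "\<dots> = ennreal (c * 2 powr d / ?m) * (\<integral>\<^sup>+y. ennreal ((1 + dist x y / t) powr (- (d + 1))) \<partial>\<mu>)"
    by (rule nn_integral_cmult) measurable
  also have "\<dots> \<le> ennreal (c * 2 powr d / ?m) * ennreal (2 powr (d + 1) * ?m)"
    by (intro mult_left_mono nn_integral_decay_le t) simp
  also have "\<dots> = ennreal (c * 2 powr (2 * d + 1))"
  proof -
    have "2 powr (2 * d + 1) = 2 powr d * 2 powr (d + 1)" by (simp flip: powr_add)
    then show ?thesis using c m by (simp add: ennreal_mult[symmetric])
  qed
  finally show ?thesis .
qed

end

section \<open>The reproducing formula on spectral spaces\<close>
lemma smooth_half_line_dilate:
  assumes sm: "smooth_half_line \<phi>" and t: "0 < t"
  shows "smooth_half_line (\<lambda>u. \<phi> (t * u))"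
proof -
  obtain D where D0: "\<And>x. 0 \<le> x \<Longrightarrow> D 0 x = \<phi> x"
    and D: "\<And>n x. 0 \<le> x \<Longrightarrow> (D n has_real_derivative D (Suc n) x) (at x within {0..})"
    using sm unfolding smooth_half_line_def by blast
  have "((\<lambda>u. t ^ n * D n (t * u)) has_real_derivative t ^ Suc n * D (Suc n) (t * x)) (at x within {0..})"
    if x: "0 \<le> x" for n x
  proof -
    have "(D n has_real_derivative D (Suc n) (t * x)) (at (t * x) within (\<lambda>u. t * u) ` {0..})"
      by (rule DERIV_subset[OF D]) (use t x in auto)
    moreover have "((\<lambda>u. t * u) has_real_derivative t) (at x within {0..})"
      by (auto intro!: derivative_eq_intros)
    ultimately have "(D n \<circ> (\<lambda>u. t * u) has_real_derivative D (Suc n) (t * x) * t) (at x within {0..})"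
      by (rule DERIV_image_chain)
    from DERIV_cmult[OF this, of "t ^ n"] show ?thesis by (simp add: o_def mult_ac)
  qed
  with t D0 show ?thesis
    unfolding smooth_half_line_def by (intro exI[of _ "\<lambda>n u. t ^ n * D n (t * u)"]) auto
qed

lemma compact_half_line_support_dilate:
  assumes supp: "half_line_support \<phi> \<subseteq> {0..b}" and t: "0 < t"
  shows "compact (half_line_support (\<lambda>u. \<phi> (t * u)))"
proof -
  have "{u. 0 \<le> u \<and> \<phi> (t * u) \<noteq> 0} \<subseteq> {0..b / t}"
  proof clarify
    fix u assume u: "0 \<le> u" "\<phi> (t * u) \<noteq> 0"
    then have "t * u \<in> half_line_support \<phi>"
      unfolding half_line_support_def using t by (intro subsetD[OF closure_subset]) auto
    with supp u t show "u \<in> {0..b / t}" by (auto simp: field_simps)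
  qed
  then have "bounded {u. 0 \<le> u \<and> \<phi> (t * u) \<noteq> 0}"
    by (rule bounded_subset[OF bounded_closed_interval])
  then show ?thesis by (simp add: half_line_support_def compact_closure)
qed

text \<open>
The dilated cutoff \<open>u \<mapsto> \<phi>(u / \<lambda>)\<close> equals \<open>1\<close> on \<open>[0, \<lambda>]\<close>, so it is one of the functions that define the
spectral space.
\<close>

lemma spectral_space_reproducing:
  fixes \<mu> :: "'a::metric_space measure"
  assumes f: "f \<in> spectral_space \<mu> L lam p" and \<phi>: "cutoff_function \<phi>" and lam: "0 < lam"
    and k: "calculus_kernel \<mu> (op_closure \<mu> L) (\<lambda>s. \<phi> (1 / lam * sqrt s)) k"
  shows "AE x in \<mu>. has_bochner_integral \<mu> (\<lambda>y. k x y * f y) (f x)"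
proof -
  let ?\<theta> = "\<lambda>u. \<phi> (1 / lam * u)"
  from \<phi> obtain b where sm: "smooth_half_line \<phi>" and b: "half_line_support \<phi> \<subseteq> {0..b}"
    and one: "\<forall>x\<in>{0..1}. \<phi> x = 1"
    unfolding cutoff_function_def by blast
  have "smooth_half_line ?\<theta>" "compact (half_line_support ?\<theta>)" "\<forall>x\<in>{0..lam}. ?\<theta> x = 1"
    using lam smooth_half_line_dilate[OF sm, of "1 / lam"]
      compact_half_line_support_dilate[OF b, of "1 / lam"] one by auto
  moreover from f have "\<forall>\<theta>. smooth_half_line \<theta> \<longrightarrow> compact (half_line_support \<theta>) \<longrightarrow> (\<forall>x \<in> {0..lam}. \<theta> x = 1) \<longrightarrow>
           (\<forall>k. calculus_kernel \<mu> (op_closure \<mu> L) (\<lambda>s. \<theta> (sqrt s)) k \<longrightarrow>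
              (AE x in \<mu>. has_bochner_integral \<mu> (\<lambda>y. k x y * f y) (f x)))"
    by (simp add: spectral_space_def)
  ultimately show ?thesis using k by blast
qed

context doubling_measure begin

lemma integrable_decay:
  assumes t: "0 < t"
  shows "integrable \<mu> (\<lambda>y. (1 + dist x y / t) powr (- (d + 1)))"
proof (rule integrableI_bounded)
  have [measurable]: "dist x \<in> borel_measurable \<mu>" by (rule measurable_dist)
  show "(\<lambda>y. (1 + dist x y / t) powr (- (d + 1))) \<in> borel_measurable \<mu>" by measurable
  show "(\<integral>\<^sup>+y. ennreal (norm ((1 + dist x y / t) powr (- (d + 1)))) \<partial>\<mu>) < \<infinity>"
    using nn_integral_decay_le[OF t, of x] by (simp add: le_less_trans[OF _ ennreal_less_top])
qed

lemma decay_le_1: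
  assumes t: "0 < t"
  shows "(1 + dist x y / t) powr (- (d + 1)) \<le> 1"
  using powr_mono2'[of "- (d + 1)" 1 "1 + dist x y / t"] t d_pos by simp

text \<open>
Since \<open>|f| \<le> 1 + |f|\<^sup>p\<close>, it suffices that the weight is integrable and at most \<open>1\<close>.
\<close>
lemma integrable_decay_mult_Lp:
  assumes t: "0 < t" and p: "1 \<le> p" and f: "f \<in> Lp_space \<mu> (ennreal p)"
  shows "integrable \<mu> (\<lambda>y. (1 + dist x y / t) powr (- (d + 1)) * norm (f y))"
proof -
  have [measurable]: "dist x \<in> borel_measurable \<mu>" by (rule measurable_dist)
  have [measurable]: "f \<in> borel_measurable \<mu>" and fp: "integrable \<mu> (\<lambda>y. norm (f y) powr p)"
    using f p by (auto simp: Lp_space_def)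
  show ?thesis
  proof (rule Bochner_Integration.integrable_bound)
    show "integrable \<mu> (\<lambda>y. (1 + dist x y / t) powr (- (d + 1)) + norm (f y) powr p)"
      by (intro Bochner_Integration.integrable_add integrable_decay t fp)
    show "AE y in \<mu>. norm ((1 + dist x y / t) powr (- (d + 1)) * norm (f y))
        \<le> norm ((1 + dist x y / t) powr (- (d + 1)) + norm (f y) powr p)"
    proof (rule AE_I2)
      fix y
      let ?w = "(1 + dist x y / t) powr (- (d + 1))"
      have w: "0 \<le> ?w" "?w \<le> 1" using decay_le_1[OF t] by auto
      have "norm (f y) \<le> 1 + norm (f y) powr p"
      proof (cases "norm (f y) \<le> 1")
        case False
        with p powr_mono[of 1 p "norm (f y)"] show ?thesis by simp
      qed (simp add: add_increasing2)
      with w have "?w * norm (f y) \<le> ?w * (1 + norm (f y) powr p)" by (intro mult_left_mono)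
      also have "\<dots> \<le> ?w + norm (f y) powr p"
        using w mult_right_mono[of ?w 1 "norm (f y) powr p"] by (simp add: distrib_left)
      finally show "norm (?w * norm (f y)) \<le> norm (?w + norm (f y) powr p)" by simp
    qed
  qed measurable
qed

lemma integrable_decay_mult_bounded:
  fixes f :: "'a \<Rightarrow> complex"
  assumes t: "0 < t" and f: "f \<in> borel_measurable \<mu>" and B: "\<And>y. norm (f y) \<le> B"
  shows "integrable \<mu> (\<lambda>y. (1 + dist x y / t) powr (- (d + 1)) * norm (f y))"
proof (rule Bochner_Integration.integrable_bound)
  have [measurable]: "dist x \<in> borel_measurable \<mu>" by (rule measurable_dist)
  note f[measurable]
  show "integrable \<mu> (\<lambda>y. B * (1 + dist x y / t) powr (- (d + 1)))"
    by (intro integrable_mult_right integrable_decay t)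
  show "(\<lambda>y. (1 + dist x y / t) powr (- (d + 1)) * norm (f y)) \<in> borel_measurable \<mu>" by measurable
  show "AE y in \<mu>. norm ((1 + dist x y / t) powr (- (d + 1)) * norm (f y))
        \<le> norm (B * (1 + dist x y / t) powr (- (d + 1)))"
  proof (rule AE_I2)
    fix y
    have "0 \<le> B" using B norm_ge_zero order_trans by blast
    then show "norm ((1 + dist x y / t) powr (- (d + 1)) * norm (f y))
        \<le> norm (B * (1 + dist x y / t) powr (- (d + 1)))"
      using mult_left_mono[OF B[of y], of "(1 + dist x y / t) powr (- (d + 1))"]
      by (simp add: mult.commute)
  qed
qed

text \<open>
Apply uniqueness of continuous representatives to \<open>max |f| c\<close> and the constant \<open>c\<close>, where \<open>c\<close> is the
essential bound.
\<close>
lemma norm_le_Lp_norm_infinity: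
  assumes f: "f \<in> Lp_space \<mu> \<infinity>" and cont: "continuous_on UNIV f"
  shows "norm (f x) \<le> Lp_norm \<mu> \<infinity> f"
proof -
  let ?c = "Lp_norm \<mu> \<infinity> f"
  have fin: "ess_bound \<mu> f < \<infinity>" using f by (simp add: Lp_space_def)
  have "AE x in \<mu>. ennreal (norm (f x)) \<le> ess_bound \<mu> f"
    unfolding ess_bound_def by (rule esssup_AE)
  then have "AE x in \<mu>. max (norm (f x)) ?c = ?c"
  proof eventually_elim
    case (elim x)
    then have "norm (f x) \<le> ?c"
      using fin by (auto simp: Lp_norm_def intro: ennreal_le_iff[THEN iffD1, rotated])
    then show ?case by simp
  qed
  then have "max (norm (f x)) ?c = ?c"
    by (rule AE_eq_continuous_imp_eq[rotated 2]) (intro continuous_intros cont)+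
  then show ?thesis by linarith
qed

lemma Lp_norm_infinity_le:
  assumes f: "f \<in> borel_measurable \<mu>" and B: "\<And>x. norm (f x) \<le> B"
  shows "Lp_norm \<mu> \<infinity> f \<le> B"
proof -
  have "0 \<le> B" using B norm_ge_zero order_trans by blast
  moreover have "ess_bound \<mu> f \<le> ennreal B"
    unfolding ess_bound_def using f B by (intro esssup_I) (auto intro: ennreal_leI)
  ultimately show ?thesis
    by (simp add: Lp_norm_def enn2real_leI)
qed

text \<open>
The Hoelder bound on the kernel makes \<open>x \<mapsto> \<integral> k(x, y) f(y) dy\<close> continuous, and two continuous functions
that agree almost everywhere agree everywhere.
\<close>
lemma reproducing_everywhere:
  fixes k :: "'a \<Rightarrow> 'a \<Rightarrow> complex" and f :: "'a \<Rightarrow> complex"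
  assumes t: "0 < t" and \<alpha>: "0 < \<alpha>" and C: "0 \<le> C"
    and k: "(\<lambda>(x, y). k x y) \<in> borel_measurable (\<mu> \<Otimes>\<^sub>M \<mu>)"
    and size: "\<And>x y. norm (k x y) \<le> C * D_kernel \<mu> t (2 * d + 1) x y"
    and hoelder: "\<And>x x' y. dist x x' \<le> t \<Longrightarrow>
          norm (k x y - k x' y) \<le> C * (dist x x' / t) powr \<alpha> * D_kernel \<mu> t (2 * d + 1) x y"
    and cont: "continuous_on UNIV f"
    and int: "\<And>x. integrable \<mu> (\<lambda>y. (1 + dist x y / t) powr (- (d + 1)) * norm (f y))"
    and ae: "AE x in \<mu>. has_bochner_integral \<mu> (\<lambda>y. k x y * f y) (f x)"
  shows "has_bochner_integral \<mu> (\<lambda>y. k x y * f y) (f x)"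
proof -
  note borel_measurable_continuous[OF cont, measurable]
  have [measurable]: "(\<lambda>y. k x y) \<in> borel_measurable \<mu>" for x
    using measurable_Pair2[OF k, of x] by (simp add: space_eq_UNIV)
  define W where "W x y = (1 + dist x y / t) powr (- (d + 1)) * norm (f y)" for x y
  define M where "M x = 2 powr d / measure \<mu> (ball x t)" for x
  have W0: "0 \<le> W x y" for x y by (simp add: W_def)
  have intW: "integrable \<mu> (W x)" for x using int[of x] by (simp add: W_def[abs_def])
  have M0: "0 \<le> M x" for x by (simp add: M_def)
  have D_le: "D_kernel \<mu> t (2 * d + 1) x y * norm (f y) \<le> M x * W x y" for x y
    unfolding W_def M_def mult.assoc[symmetric] by (intro mult_right_mono D_kernel_le t) simp
  have int_k: "integrable \<mu> (\<lambda>y. k x y * f y)" for x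
  proof (rule Bochner_Integration.integrable_bound)
    show "integrable \<mu> (\<lambda>y. C * (M x * W x y))" by (intro integrable_mult_right intW)
    show "AE y in \<mu>. norm (k x y * f y) \<le> norm (C * (M x * W x y))"
    proof (rule AE_I2)
      fix y
      have "norm (k x y * f y) \<le> C * (D_kernel \<mu> t (2 * d + 1) x y * norm (f y))"
        using mult_right_mono[OF size[of x y], of "norm (f y)"] by (simp add: norm_mult mult.assoc)
      also have "\<dots> \<le> C * (M x * W x y)" by (intro mult_left_mono D_le C)
      finally show "norm (k x y * f y) \<le> norm (C * (M x * W x y))" by simp
    qed
  qed measurable
  define g where "g x = (LINT y|\<mu>. k x y * f y)" for x
  have g_diff: "norm (g z - g x) \<le> C * (dist x z / t) powr \<alpha> * (M x * (LINT y|\<mu>. W x y))"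
    if z: "dist x z \<le> t" for x z
  proof -
    let ?c = "C * (dist x z / t) powr \<alpha>"
    have "norm (g z - g x) = norm (LINT y|\<mu>. k z y * f y - k x y * f y)"
      by (simp add: g_def Bochner_Integration.integral_diff[OF int_k int_k])
    also have "\<dots> \<le> (LINT y|\<mu>. ?c * (M x * W x y))"
    proof (rule order_trans[OF integral_norm_bound integral_mono])
      show "integrable \<mu> (\<lambda>y. norm (k z y * f y - k x y * f y))"
        by (intro integrable_norm Bochner_Integration.integrable_diff int_k)
      show "integrable \<mu> (\<lambda>y. ?c * (M x * W x y))" by (intro integrable_mult_right intW)
      fix y
      have "norm (k z y * f y - k x y * f y) = norm (k x y - k z y) * norm (f y)"
        by (metis left_diff_distrib norm_minus_commute norm_mult)
      also have "\<dots> \<le> ?c * D_kernel \<mu> t (2 * d + 1) x y * norm (f y)"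
        by (intro mult_right_mono hoelder z) simp
      also have "\<dots> \<le> ?c * (M x * W x y)"
        using mult_left_mono[OF D_le[of x y], of ?c] C by (simp add: mult.assoc)
      finally show "norm (k z y * f y - k x y * f y) \<le> ?c * (M x * W x y)" .
    qed
    finally show ?thesis by simp
  qed
  have "continuous_on UNIV g"
  proof (rule continuous_at_imp_continuous_on, rule ballI)
    fix x :: 'a
    have "((\<lambda>z. dist x z / t) \<longlongrightarrow> dist x x / t) (at x)"
      using t by (intro tendsto_intros) auto
    then have "((\<lambda>z. (dist x z / t) powr \<alpha>) \<longlongrightarrow> 0) (at x)"
      using t \<alpha> by (intro tendsto_zero_powrI[of _ _ _ \<alpha>]) auto
    then have lim: "((\<lambda>z. C * (dist x z / t) powr \<alpha> * (M x * (LINT y|\<mu>. W x y))) \<longlongrightarrow> 0) (at x)"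
      by (intro tendsto_mult_left_zero tendsto_mult_right_zero)
    have "\<forall>\<^sub>F z in at x. dist x z \<le> t"
      using t by (auto simp: eventually_at dist_commute intro!: exI[of _ t])
    then have "\<forall>\<^sub>F z in at x. norm (g z - g x) \<le> C * (dist x z / t) powr \<alpha> * (M x * (LINT y|\<mu>. W x y))"
      by eventually_elim (rule g_diff)
    from Lim_null_comparison[OF this lim] show "isCont g x"
      by (simp add: isCont_def LIM_zero_iff)
  qed
  moreover have "AE x in \<mu>. g x = f x"
    using ae by eventually_elim (simp add: g_def has_bochner_integral_iff)
  ultimately have "g x = f x"
    using cont by (intro AE_eq_continuous_imp_eq)
  then show ?thesis using int_k[of x] by (simp add: has_bochner_integral_iff g_def)
qed

end

section \<open>Discretisation along a partition\<close>

locale net_partition = doubling_measure \<mu> d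
  for \<mu> :: "'a::metric_space measure" and d :: real +
  fixes X :: "'a set" and A :: "'a \<Rightarrow> 'a set" and \<delta> :: real
  assumes delta_pos: "0 < \<delta>"
    and cell_sets: "\<And>\<xi>. \<xi> \<in> X \<Longrightarrow> A \<xi> \<in> sets \<mu>"
    and cell_disjoint: "disjoint_family_on A X"
    and cell_cover: "(\<Union>\<xi>\<in>X. A \<xi>) = UNIV"
    and cell_inner: "\<And>\<xi>. \<xi> \<in> X \<Longrightarrow> ball \<xi> (\<delta> / 2) \<subseteq> A \<xi>"
    and cell_outer: "\<And>\<xi>. \<xi> \<in> X \<Longrightarrow> A \<xi> \<subseteq> ball \<xi> \<delta>"
begin

definition cell_point :: "'a \<Rightarrow> 'a" where
  "cell_point x = (THE \<xi>. \<xi> \<in> X \<and> x \<in> A \<xi>)"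

lemma cell_point_eq: "\<xi> \<in> X \<Longrightarrow> x \<in> A \<xi> \<Longrightarrow> cell_point x = \<xi>"
  unfolding cell_point_def using cell_disjoint
  by (intro the_equality) (auto simp: disjoint_family_on_def)

lemma cell_point_in: "cell_point x \<in> X" and in_cell: "x \<in> A (cell_point x)"
proof -
  obtain \<xi> where "\<xi> \<in> X" "x \<in> A \<xi>" using cell_cover by blast
  then show "cell_point x \<in> X" "x \<in> A (cell_point x)" by (auto simp: cell_point_eq)
qed

lemma dist_cell_point: "dist x (cell_point x) < \<delta>"
  using subsetD[OF cell_outer[OF cell_point_in] in_cell] by (simp add: dist_commute)

lemma emeasure_cell_finite: "\<xi> \<in> X \<Longrightarrow> emeasure \<mu> (A \<xi>) < \<infinity>"
  using emeasure_mono[OF cell_outer ball_sets] emeasure_ball_finite[OF delta_pos] by (rule le_less_trans)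

lemma emeasure_cell: "\<xi> \<in> X \<Longrightarrow> emeasure \<mu> (A \<xi>) = ennreal (measure \<mu> (A \<xi>))"
  using emeasure_cell_finite[of \<xi>] by (intro emeasure_eq_ennreal_measure) auto

lemma measure_cell_pos:
  assumes \<xi>: "\<xi> \<in> X"
  shows "0 < measure \<mu> (A \<xi>)"
proof -
  have "0 < emeasure \<mu> (ball \<xi> (\<delta> / 2))" using delta_pos by (intro emeasure_ball_pos) simp
  also have "\<dots> \<le> emeasure \<mu> (A \<xi>)" by (intro emeasure_mono cell_inner cell_sets \<xi>)
  finally show ?thesis by (simp add: emeasure_cell[OF \<xi>])
qed

text \<open>
The cells with centre in a fixed ball are disjoint, have positive measure and lie in a larger ball
of finite measure, so their measures are summable and there are countably many of them.
\<close>
lemma countable_net: "countable X"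
proof -
  fix o' :: 'a
  define Xn where "Xn n = {\<xi> \<in> X. dist o' \<xi> < real n}" for n :: nat
  have "countable (Xn n)" for n
  proof -
    have "(\<lambda>\<xi>. measure \<mu> (A \<xi>)) summable_on Xn n"
    proof (rule nonneg_bdd_above_summable_on)
      show "bdd_above (sum (\<lambda>\<xi>. measure \<mu> (A \<xi>)) ` {F. F \<subseteq> Xn n \<and> finite F})"
      proof (rule bdd_aboveI2)
        fix F assume "F \<in> {F. F \<subseteq> Xn n \<and> finite F}"
        then have F: "F \<subseteq> Xn n" "finite F" by auto
        then have FX: "F \<subseteq> X" by (auto simp: Xn_def)
        have "ennreal (\<Sum>\<xi>\<in>F. measure \<mu> (A \<xi>)) = (\<Sum>\<xi>\<in>F. emeasure \<mu> (A \<xi>))"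
          using FX by (simp add: emeasure_cell subset_iff sum_ennreal)
        also have "\<dots> = emeasure \<mu> (\<Union>\<xi>\<in>F. A \<xi>)"
          using FX F(2) disjoint_family_on_mono[OF FX cell_disjoint]
          by (intro sum_emeasure) (auto intro: cell_sets)
        also have "\<dots> \<le> emeasure \<mu> (ball o' (real n + \<delta>))"
        proof (intro emeasure_mono ball_sets UN_least)
          fix \<xi> assume "\<xi> \<in> F"
          then have "\<xi> \<in> X" "dist o' \<xi> < real n" using F by (auto simp: Xn_def)
          then show "A \<xi> \<subseteq> ball o' (real n + \<delta>)"
            using cell_outer[of \<xi>] dist_triangle_less_add[of o' \<xi>]
            by (force simp: dist_commute)
        qed
        also have "\<dots> = ennreal (measure \<mu> (ball o' (real n + \<delta>)))"
          using delta_pos by (intro emeasure_ball) simp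
        finally show "(\<Sum>\<xi>\<in>F. measure \<mu> (A \<xi>)) \<le> measure \<mu> (ball o' (real n + \<delta>))"
          by simp
      qed
    qed simp
    then have "countable {\<xi> \<in> Xn n. measure \<mu> (A \<xi>) \<noteq> 0}" by (rule summable_countable_real)
    moreover have "{\<xi> \<in> Xn n. measure \<mu> (A \<xi>) \<noteq> 0} = Xn n"
      using measure_cell_pos by (force simp: Xn_def)
    ultimately show ?thesis by simp
  qed
  moreover have "X = (\<Union>n. Xn n)" using reals_Archimedean2 by (auto simp: Xn_def)
  ultimately show ?thesis by (metis countable_UN countableI_type)
qed

lemma measurable_cell_point: "cell_point \<in> measurable \<mu> (count_space X)"
proof -
  have "cell_point -` {\<xi>} \<inter> space \<mu> = A \<xi>" if "\<xi> \<in> X" for \<xi>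
    using that in_cell cell_point_eq by (auto simp: space_eq_UNIV)
  then show ?thesis
    using cell_point_in cell_sets countable_net
    by (simp add: measurable_count_space_eq_countable)
qed

lemma measurable_comp_cell_point:
  fixes g :: "'a \<Rightarrow> 'b::topological_space"
  shows "(\<lambda>x. g (cell_point x)) \<in> borel_measurable \<mu>"
  by (rule measurable_compose[OF measurable_cell_point]) simp

text \<open>
The weighted sum over the net is the integral of the step function \<open>x \<mapsto> g(\<xi>)\<close> for \<open>x \<in> A\<^sub>\<xi>\<close>. Hence
sampling is a question about how well this step function approximates \<open>f\<close> in \<open>L\<^sup>p\<close>.
\<close>
lemma nn_integral_comp_cell_point:
  assumes g: "\<And>\<xi>. 0 \<le> g \<xi>"
  shows "(\<integral>\<^sup>+x. ennreal (g (cell_point x)) \<partial>\<mu>) = (\<integral>\<^sup>+\<xi>. ennreal (measure \<mu> (A \<xi>) * g \<xi>) \<partial>count_space X)"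
proof -
  have "(\<integral>\<^sup>+x. ennreal (g (cell_point x)) \<partial>\<mu>)
      = (\<integral>\<^sup>+x. \<integral>\<^sup>+\<xi>. ennreal (g \<xi>) * indicator (A \<xi>) x \<partial>count_space X \<partial>\<mu>)"
  proof (rule nn_integral_cong)
    fix x
    have "(\<integral>\<^sup>+\<xi>. ennreal (g \<xi>) * indicator (A \<xi>) x \<partial>count_space X)
        = (\<Sum>\<xi>\<in>{cell_point x}. ennreal (g \<xi>) * indicator (A \<xi>) x)"
      using cell_point_in cell_point_eq
      by (intro nn_integral_count_space') (auto simp: indicator_def)
    then show "ennreal (g (cell_point x)) = (\<integral>\<^sup>+\<xi>. ennreal (g \<xi>) * indicator (A \<xi>) x \<partial>count_space X)"
      using in_cell by simp
  qed
  also have "\<dots> = (\<integral>\<^sup>+\<xi>. \<integral>\<^sup>+x. ennreal (g \<xi>) * indicator (A \<xi>) x \<partial>\<mu> \<partial>count_space X)"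
    by (rule nn_integral_count_space_nn_integral[OF countable_net]) (use cell_sets in measurable)
  also have "\<dots> = (\<integral>\<^sup>+\<xi>. ennreal (measure \<mu> (A \<xi>) * g \<xi>) \<partial>count_space X)"
    using g by (intro nn_integral_cong)
      (simp add: nn_integral_cmult_indicator cell_sets emeasure_cell ennreal_mult mult.commute)
  finally show ?thesis .
qed

lemma infsum_cells:
  assumes g: "\<And>\<xi>. 0 \<le> g \<xi>" and fin: "(\<integral>\<^sup>+x. ennreal (g (cell_point x)) \<partial>\<mu>) < \<infinity>"
  shows "(\<lambda>\<xi>. measure \<mu> (A \<xi>) * g \<xi>) summable_on X"
    and "ennreal (\<Sum>\<^sub>\<infinity>\<xi>\<in>X. measure \<mu> (A \<xi>) * g \<xi>) = (\<integral>\<^sup>+x. ennreal (g (cell_point x)) \<partial>\<mu>)"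
proof -
  let ?a = "\<lambda>\<xi>. measure \<mu> (A \<xi>) * g \<xi>"
  have eq: "(\<integral>\<^sup>+x. ennreal (g (cell_point x)) \<partial>\<mu>) = (\<integral>\<^sup>+\<xi>. ennreal (?a \<xi>) \<partial>count_space X)"
    by (rule nn_integral_comp_cell_point[OF g])
  have "integrable (count_space X) ?a"
    using fin g by (intro integrableI_bounded) (auto simp: eq)
  then have abs: "Infinite_Set_Sum.abs_summable_on ?a X"
    by (simp add: Infinite_Set_Sum.abs_summable_on_def)
  then have "(\<lambda>\<xi>. norm (?a \<xi>)) summable_on X"
    by (rule abs_summable_equivalent[THEN iffD2])
  then show "?a summable_on X" using g by simp
  have "(\<integral>\<^sup>+\<xi>. ennreal (?a \<xi>) \<partial>count_space X) = ennreal (infsetsum ?a X)"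
    unfolding infsetsum_def using g \<open>integrable (count_space X) ?a\<close>
    by (intro nn_integral_eq_integral) auto
  then show "ennreal (infsum ?a X) = (\<integral>\<^sup>+x. ennreal (g (cell_point x)) \<partial>\<mu>)"
    by (simp add: eq infsetsum_infsum[OF abs])
qed

lemma oscillation_le:
  fixes f :: "'a \<Rightarrow> complex"
  assumes repr: "\<And>x. has_bochner_integral \<mu> (\<lambda>y. k x y * f y) (f x)"
  shows "ennreal (norm (f x - f (cell_point x)))
     \<le> (\<integral>\<^sup>+y. ennreal (norm (k x y - k (cell_point x) y) * norm (f y)) \<partial>\<mu>)"
proof -
  have "has_bochner_integral \<mu> (\<lambda>y. k x y * f y - k (cell_point x) y * f y) (f x - f (cell_point x))"
    by (intro has_bochner_integral_diff repr)
  then have "ennreal (norm (f x - f (cell_point x)))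
     \<le> (\<integral>\<^sup>+y. ennreal (norm (k x y * f y - k (cell_point x) y * f y)) \<partial>\<mu>)"
    using integral_norm_bound_ennreal by (metis has_bochner_integral_iff)
  then show ?thesis by (simp add: left_diff_distrib[symmetric] norm_mult)
qed

text \<open>
Schur's test, with the mass bound for \<open>D\<close> along both variables, shows that \<open>f\<close> and its step function
differ by at most \<open>Q \<parallel>f\<parallel>\<^sub>p\<close>. The test is applied to \<open>|k(x, y) - k(\<xi>\<^sub>x, y)|\<close>, with \<open>\<xi>\<^sub>x\<close> the net point
of the cell of \<open>x\<close>, and not to its majorant \<open>D(x, y)\<close>: the former is jointly measurable because
\<open>x \<mapsto> \<xi>\<^sub>x\<close> takes countably many values, whereas joint measurability of the distance with respect to
the product \<open>\<sigma>\<close>-algebra is a question about the separability of the space.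
\<close>
lemma sampling_Lp:
  fixes f :: "'a \<Rightarrow> complex" and k :: "'a \<Rightarrow> 'a \<Rightarrow> complex"
  assumes t: "0 < t" and c: "0 < c" and Q: "Q = c * 2 powr (2 * d + 1)" "Q < 1" and p: "1 \<le> p"
    and k[measurable]: "(\<lambda>(x, y). k x y) \<in> borel_measurable (\<mu> \<Otimes>\<^sub>M \<mu>)"
    and k_le: "\<And>x y. norm (k x y - k (cell_point x) y) \<le> c * D_kernel \<mu> t (2 * d + 1) x y"
    and repr: "\<And>x. has_bochner_integral \<mu> (\<lambda>y. k x y * f y) (f x)"
    and f: "f \<in> Lp_space \<mu> (ennreal p)"
  defines "S \<equiv> \<Sum>\<^sub>\<infinity>\<xi>\<in>X. measure \<mu> (A \<xi>) * norm (f \<xi>) powr p"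
    and "F \<equiv> Lp_norm \<mu> (ennreal p) f"
  shows "(\<lambda>\<xi>. measure \<mu> (A \<xi>) * norm (f \<xi>) powr p) summable_on X"
    and "((1 - Q) * F) powr p \<le> S" and "S \<le> ((1 + Q) * F) powr p"
proof -
  have [measurable]: "f \<in> borel_measurable \<mu>" and fp: "integrable \<mu> (\<lambda>y. norm (f y) powr p)"
    using f p by (auto simp: Lp_space_def)
  have [measurable]: "(\<lambda>x. f (cell_point x)) \<in> borel_measurable \<mu>" by (rule measurable_comp_cell_point)
  have Q0: "0 < Q" using c Q by simp
  define G where "G = (LINT x|\<mu>. norm (f x) powr p)"
  have G0: "0 \<le> G" by (simp add: G_def)
  have FG: "F = G powr (1 / p)" using p by (simp add: F_def G_def Lp_norm_def)
  have Fp: "F powr p = G" and F0: "0 \<le> F" using p G0 by (simp_all add: FG powr_powr)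
  have fG: "(\<integral>\<^sup>+x. ennreal (norm (f x) powr p) \<partial>\<mu>) = ennreal G"
    unfolding G_def by (rule nn_integral_eq_integral[OF fp]) simp
  define \<kappa> where "\<kappa> x y = norm (k x y - k (cell_point x) y)" for x y
  have \<kappa>m: "(\<lambda>(x, y). \<kappa> x y) \<in> borel_measurable (\<mu> \<Otimes>\<^sub>M \<mu>)"
  proof -
    have "(\<lambda>z. k (cell_point (fst z)) (snd z)) \<in> borel_measurable (\<mu> \<Otimes>\<^sub>M \<mu>)"
    proof (rule measurable_compose_countable'[where f = "\<lambda>\<xi> z. k \<xi> (snd z)"
          and g = "\<lambda>z. cell_point (fst z)", OF _ _ countable_net])
      show "(\<lambda>z. k \<xi> (snd z)) \<in> borel_measurable (\<mu> \<Otimes>\<^sub>M \<mu>)" for \<xi>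
        using measurable_compose[OF measurable_snd measurable_Pair2[OF k, of \<xi>]]
        by (simp add: space_eq_UNIV)
      show "(\<lambda>z. cell_point (fst z)) \<in> measurable (\<mu> \<Otimes>\<^sub>M \<mu>) (count_space X)"
        by (rule measurable_compose[OF measurable_fst measurable_cell_point])
    qed
    then show ?thesis unfolding \<kappa>_def by (simp add: case_prod_beta)
  qed
  have \<kappa>_le: "\<kappa> x y \<le> c * D_kernel \<mu> t (2 * d + 1) x y" for x y
    unfolding \<kappa>_def by (rule k_le)
  have "(\<integral>\<^sup>+x. ennreal (norm (f x - f (cell_point x)) powr p) \<partial>\<mu>)
      \<le> ennreal (Q powr p) * (\<integral>\<^sup>+x. ennreal (norm (f x) powr p) \<partial>\<mu>)"
  proof (rule schur_test_powr[OF sigma_finite p Q0 \<kappa>m])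
    show "(\<integral>\<^sup>+y. ennreal (\<kappa> x y) \<partial>\<mu>) \<le> ennreal Q" for x
      unfolding Q(1) using c by (intro nn_integral_D_kernel_le[OF t _ \<kappa>_le]) simp
    show "(\<integral>\<^sup>+x. ennreal (\<kappa> x y) \<partial>\<mu>) \<le> ennreal Q" for y
      unfolding Q(1) using c \<kappa>_le D_kernel_commute[of t "2 * d + 1" y]
      by (intro nn_integral_D_kernel_le[OF t, where x = y]) auto
    show "ennreal (norm (f x - f (cell_point x))) \<le> (\<integral>\<^sup>+y. ennreal (\<kappa> x y * norm (f y)) \<partial>\<mu>)" for x
      unfolding \<kappa>_def by (rule oscillation_le[OF repr])
  qed (auto simp: \<kappa>_def)
  then have h: "(\<integral>\<^sup>+x. ennreal (norm (f x - f (cell_point x)) powr p) \<partial>\<mu>)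
      \<le> ennreal (Q powr p) * ennreal G" by (simp only: fG)
  have le: "norm (f x) \<le> norm (f (cell_point x)) + norm (f x - f (cell_point x))"
    "norm (f (cell_point x)) \<le> norm (f x) + norm (f x - f (cell_point x))" for x
    using norm_triangle_sub[of "f x" "f (cell_point x)"] norm_triangle_sub[of "f (cell_point x)" "f x"]
    by (simp_all add: norm_minus_commute)
  have meas: "(\<lambda>x. norm (f x)) \<in> borel_measurable \<mu>" "(\<lambda>x. norm (f (cell_point x))) \<in> borel_measurable \<mu>"
    "(\<lambda>x. norm (f x - f (cell_point x))) \<in> borel_measurable \<mu>" by measurable
  note pert = nn_integral_powr_perturbation[OF p Q0 Q(2) meas norm_ge_zero norm_ge_zero norm_ge_zero le fG G0 h]
  have fin: "(\<integral>\<^sup>+x. ennreal (norm (f (cell_point x)) powr p) \<partial>\<mu>) < \<infinity>"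
    using pert(2) by (rule le_less_trans) simp
  note cells = infsum_cells[of "\<lambda>\<xi>. norm (f \<xi>) powr p", OF _ fin]
  show "(\<lambda>\<xi>. measure \<mu> (A \<xi>) * norm (f \<xi>) powr p) summable_on X" by (rule cells(1)) simp
  have S0: "0 \<le> S" unfolding S_def by (intro infsum_nonneg) simp
  have S: "ennreal S = (\<integral>\<^sup>+x. ennreal (norm (f (cell_point x)) powr p) \<partial>\<mu>)"
    unfolding S_def by (rule cells(2)) simp
  show "((1 - Q) * F) powr p \<le> S"
    using pert(1) S0 Q(2) F0 by (simp add: S[symmetric] powr_mult Fp)
  show "S \<le> ((1 + Q) * F) powr p"
    using pert(2) S0 G0 by (simp add: S[symmetric] powr_mult Fp)
qed

text \<open>
Here the mass bound for \<open>D\<close> acts directly: \<open>|f(x) - f(\<xi>\<^sub>x)| \<le> Q \<parallel>f\<parallel>\<^sub>\<infinity>\<close> for every \<open>x\<close>.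
\<close>
lemma sampling_sup:
  fixes f :: "'a \<Rightarrow> complex" and k :: "'a \<Rightarrow> 'a \<Rightarrow> complex"
  assumes t: "0 < t" and c: "0 < c" and Q: "Q = c * 2 powr (2 * d + 1)"
    and k_le: "\<And>x y. norm (k x y - k (cell_point x) y) \<le> c * D_kernel \<mu> t (2 * d + 1) x y"
    and repr: "\<And>x. has_bochner_integral \<mu> (\<lambda>y. k x y * f y) (f x)"
    and f: "f \<in> Lp_space \<mu> \<infinity>" and cont: "continuous_on UNIV f"
  shows "bdd_above ((\<lambda>\<xi>. norm (f \<xi>)) ` X)"
    and "(1 - Q) * Lp_norm \<mu> \<infinity> f \<le> (SUP \<xi>\<in>X. norm (f \<xi>))"
    and "(SUP \<xi>\<in>X. norm (f \<xi>)) \<le> Lp_norm \<mu> \<infinity> f"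
proof -
  let ?N = "Lp_norm \<mu> \<infinity> f"
  have N: "norm (f x) \<le> ?N" for x by (rule norm_le_Lp_norm_infinity[OF f cont])
  then have N0: "0 \<le> ?N" using norm_ge_zero order_trans by blast
  show bdd: "bdd_above ((\<lambda>\<xi>. norm (f \<xi>)) ` X)" by (rule bdd_aboveI2) (rule N)
  show "(SUP \<xi>\<in>X. norm (f \<xi>)) \<le> ?N" using cell_point_in by (intro cSUP_least N) auto
  have "norm (f x) \<le> (SUP \<xi>\<in>X. norm (f \<xi>)) + Q * ?N" for x
  proof -
    have "ennreal (norm (f x - f (cell_point x)))
        \<le> (\<integral>\<^sup>+y. ennreal (norm (k x y - k (cell_point x) y) * norm (f y)) \<partial>\<mu>)"
      by (rule oscillation_le[OF repr])
    also have "\<dots> \<le> ennreal (c * ?N * 2 powr (2 * d + 1))"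
    proof (rule nn_integral_D_kernel_le[OF t])
      fix y
      have "norm (k x y - k (cell_point x) y) * norm (f y) \<le> c * D_kernel \<mu> t (2 * d + 1) x y * ?N"
        using c by (intro mult_mono k_le N) (auto simp: D_kernel_nonneg)
      then show "norm (k x y - k (cell_point x) y) * norm (f y) \<le> c * ?N * D_kernel \<mu> t (2 * d + 1) x y"
        by (simp add: mult_ac)
    qed (use c N0 in simp)
    finally have "norm (f x - f (cell_point x)) \<le> Q * ?N"
      using c N0 by (subst (asm) ennreal_le_iff) (auto simp: Q mult_ac)
    moreover have "norm (f (cell_point x)) \<le> (SUP \<xi>\<in>X. norm (f \<xi>))"
      by (rule cSUP_upper[OF cell_point_in bdd])
    ultimately show ?thesis using norm_triangle_sub[of "f x" "f (cell_point x)"] by linarith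
  qed
  then have "?N \<le> (SUP \<xi>\<in>X. norm (f \<xi>)) + Q * ?N"
    using f by (intro Lp_norm_infinity_le) (auto simp: Lp_space_def)
  then show "(1 - Q) * ?N \<le> (SUP \<xi>\<in>X. norm (f \<xi>))" by (simp add: left_diff_distrib)
qed

end

section \<open>The sampling theorem\<close>

theorem theorem4p2:
  fixes \<mu> :: "'a::metric_space measure"
    and L :: "'a op_graph"
    and hk :: "real \<Rightarrow> 'a \<Rightarrow> 'a \<Rightarrow> real"
    and d \<alpha> \<gamma> lam \<delta> \<sigma>\<^sub>0 :: real
    and \<phi> :: "real \<Rightarrow> real"
    and \<Phi> :: "real \<Rightarrow> 'a \<Rightarrow> 'a \<Rightarrow> complex"
    and K :: "real \<Rightarrow> real"
    and X :: "'a set"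
    and A :: "'a \<Rightarrow> 'a set"
  assumes setting: "heat_kernel_setting \<mu> L hk d \<alpha>"
    and cutoff: "cutoff_function \<phi>"
    and kernel: "\<And>t. 0 < t \<Longrightarrow> t \<le> 1 \<Longrightarrow>
          calculus_kernel \<mu> (op_closure \<mu> L) (\<lambda>s. \<phi> (t * sqrt s)) (\<Phi> t)"
    and K_gt_1: "\<And>\<sigma>. 0 < \<sigma> \<Longrightarrow> 1 < K \<sigma>"
    and K_bound: "\<And>\<sigma> t x y. 0 < \<sigma> \<Longrightarrow> 0 < t \<Longrightarrow> t \<le> 1 \<Longrightarrow>
          norm (\<Phi> t x y) \<le> K \<sigma> * D_kernel \<mu> t \<sigma> x y"
    and K_hoelder: "\<And>\<sigma> t x x' y. 0 < \<sigma> \<Longrightarrow> 0 < t \<Longrightarrow> t \<le> 1 \<Longrightarrow> dist x x' \<le> t \<Longrightarrow>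
          norm (\<Phi> t x y - \<Phi> t x' y) \<le> K \<sigma> * (dist x x' / t) powr \<alpha> * D_kernel \<mu> t \<sigma> x y"
    and sigma: "\<sigma>\<^sub>0 = 2 * d + 1"
    and gamma: "0 < \<gamma>" "\<gamma> < 1"
    and lambda: "1 \<le> lam"
    and delta: "\<delta> = \<gamma> / lam"
    and net: "maximal_delta_net \<delta> X"
    and partition_sets: "\<And>\<xi>. \<xi> \<in> X \<Longrightarrow> A \<xi> \<in> sets \<mu>"
    and partition_disjoint: "disjoint_family_on A X"
    and partition_cover: "(\<Union>\<xi>\<in>X. A \<xi>) = UNIV"
    and partition_balls: "\<And>\<xi>. \<xi> \<in> X \<Longrightarrow> ball \<xi> (\<delta> / 2) \<subseteq> A \<xi> \<and> A \<xi> \<subseteq> ball \<xi> \<delta>"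
  shows
    "(K \<sigma>\<^sub>0 * \<gamma> powr \<alpha> * 2 powr (2 * d + 1) \<le> 1 / 2 \<longrightarrow>
        (\<forall>p::real. \<forall>f. 1 \<le> p \<longrightarrow> f \<in> spectral_space \<mu> L lam (ennreal p) \<longrightarrow>
           (\<lambda>\<xi>. measure \<mu> (A \<xi>) * norm (f \<xi>) powr p) summable_on X \<and>
           1 / 2 * Lp_norm \<mu> (ennreal p) f
             \<le> (\<Sum>\<^sub>\<infinity>\<xi>\<in>X. measure \<mu> (A \<xi>) * norm (f \<xi>) powr p) powr (1 / p) \<and>
           (\<Sum>\<^sub>\<infinity>\<xi>\<in>X. measure \<mu> (A \<xi>) * norm (f \<xi>) powr p) powr (1 / p)
             \<le> 2 * Lp_norm \<mu> (ennreal p) f) \<and>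
        (\<forall>f \<in> spectral_space \<mu> L lam \<infinity>.
           bdd_above ((\<lambda>\<xi>. norm (f \<xi>)) ` X) \<and>
           1 / 2 * Lp_norm \<mu> \<infinity> f \<le> (SUP \<xi>\<in>X. norm (f \<xi>)) \<and>
           (SUP \<xi>\<in>X. norm (f \<xi>)) \<le> Lp_norm \<mu> \<infinity> f)) \<and>
     (\<forall>\<epsilon>::real. 0 < \<epsilon> \<longrightarrow> \<epsilon> < 1 \<longrightarrow> K \<sigma>\<^sub>0 * \<gamma> powr \<alpha> * 2 powr (2 * d + 1) \<le> \<epsilon> / 3 \<longrightarrow>
        (\<forall>p::real. \<forall>f. 1 \<le> p \<longrightarrow> p \<le> 2 \<longrightarrow> f \<in> spectral_space \<mu> L lam (ennreal p) \<longrightarrow>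
           (\<lambda>\<xi>. measure \<mu> (A \<xi>) * norm (f \<xi>) powr p) summable_on X \<and>
           (1 - \<epsilon>) * Lp_norm \<mu> (ennreal p) f powr p
             \<le> (\<Sum>\<^sub>\<infinity>\<xi>\<in>X. measure \<mu> (A \<xi>) * norm (f \<xi>) powr p) \<and>
           (\<Sum>\<^sub>\<infinity>\<xi>\<in>X. measure \<mu> (A \<xi>) * norm (f \<xi>) powr p)
             \<le> (1 + \<epsilon>) * Lp_norm \<mu> (ennreal p) f powr p))"
proof -
  interpret setting: heat_kernel_setting \<mu> L hk d \<alpha> by (rule setting)
  have \<delta>0: "0 < \<delta>" using gamma lambda by (simp add: delta)
  interpret net_partition \<mu> d X A \<delta>
  proof
    show "sets \<mu> = sets borel" using setting.radon by (simp add: radon_measure_def)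
  qed (use setting.d_pos setting.doubling \<delta>0 partition_sets partition_disjoint partition_cover
      partition_balls in blast)+
  \<comment> \<open>The scale at which the cutoff reproduces functions of frequency at most \<open>lam\<close>.\<close>
  define t where "t = 1 / lam"
  have t: "0 < t" "t \<le> 1" and \<delta>t: "\<delta> = \<gamma> * t" using lambda by (auto simp: t_def delta)
  have K: "1 < K \<sigma>\<^sub>0" using K_gt_1 d_pos by (simp add: sigma)
  define c where "c = K \<sigma>\<^sub>0 * \<gamma> powr \<alpha>"
  define Q where "Q = c * 2 powr (2 * d + 1)"
  have c: "0 < c" using K gamma by (simp add: c_def)
  then have Q0: "0 < Q" by (simp add: Q_def)
  note ker = kernel[OF t]
  have meas: "(\<lambda>(x, y). \<Phi> t x y) \<in> borel_measurable (\<mu> \<Otimes>\<^sub>M \<mu>)"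
    using ker by (simp add: calculus_kernel_def)
  have size: "norm (\<Phi> t x y) \<le> K \<sigma>\<^sub>0 * D_kernel \<mu> t (2 * d + 1) x y" for x y
    using K_bound[of \<sigma>\<^sub>0 t x y] t d_pos by (simp add: sigma)
  have hoelder: "norm (\<Phi> t x y - \<Phi> t x' y) \<le> K \<sigma>\<^sub>0 * (dist x x' / t) powr \<alpha> * D_kernel \<mu> t (2 * d + 1) x y"
    if "dist x x' \<le> t" for x x' y
    using K_hoelder[of \<sigma>\<^sub>0 t x x' y] t d_pos that by (simp add: sigma)
  \<comment> \<open>Since \<open>\<delta> = \<gamma> t\<close>, each point is so close to its net point that the Hoelder factor is at most \<open>\<gamma>\<^sup>\<alpha>\<close>.\<close>
  have osc: "norm (\<Phi> t x y - \<Phi> t (cell_point x) y) \<le> c * D_kernel \<mu> t (2 * d + 1) x y" for x y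
  proof -
    have le: "dist x (cell_point x) \<le> \<gamma> * t" using dist_cell_point[of x] by (simp add: \<delta>t)
    also have "\<dots> \<le> t" using gamma t by (simp add: mult_left_le_one_le)
    finally have "norm (\<Phi> t x y - \<Phi> t (cell_point x) y)
      \<le> K \<sigma>\<^sub>0 * (dist x (cell_point x) / t) powr \<alpha> * D_kernel \<mu> t (2 * d + 1) x y"
      by (rule hoelder)
    also have "\<dots> \<le> K \<sigma>\<^sub>0 * \<gamma> powr \<alpha> * D_kernel \<mu> t (2 * d + 1) x y"
      using le t K setting.alpha_pos
      by (intro mult_right_mono mult_left_mono powr_mono2 D_kernel_nonneg) (auto simp: divide_le_eq)
    finally show ?thesis by (simp add: c_def)
  qed
  have repr: "has_bochner_integral \<mu> (\<lambda>y. \<Phi> t x y * f y) (f x)"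
    if f: "f \<in> spectral_space \<mu> L lam p"
      and int: "\<And>x. integrable \<mu> (\<lambda>y. (1 + dist x y / t) powr (- (d + 1)) * norm (f y))" for f p x
  proof (rule reproducing_everywhere[OF t(1) setting.alpha_pos _ meas size hoelder _ int])
    show "AE x in \<mu>. has_bochner_integral \<mu> (\<lambda>y. \<Phi> t x y * f y) (f x)"
      using f cutoff ker lambda unfolding t_def by (intro spectral_space_reproducing[where lam = lam]) auto
    show "continuous_on UNIV f" using f by (simp add: spectral_space_def)
  qed (use K in auto)

  have finite_p: "(\<lambda>\<xi>. measure \<mu> (A \<xi>) * norm (f \<xi>) powr p) summable_on X"
      "((1 - Q) * Lp_norm \<mu> (ennreal p) f) powr p \<le> (\<Sum>\<^sub>\<infinity>\<xi>\<in>X. measure \<mu> (A \<xi>) * norm (f \<xi>) powr p)"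
      "(\<Sum>\<^sub>\<infinity>\<xi>\<in>X. measure \<mu> (A \<xi>) * norm (f \<xi>) powr p) \<le> ((1 + Q) * Lp_norm \<mu> (ennreal p) f) powr p"
    if Q1: "Q < 1" and p: "1 \<le> p" and f: "f \<in> spectral_space \<mu> L lam (ennreal p)" for f p
  proof -
    have fp: "f \<in> Lp_space \<mu> (ennreal p)" using f by (simp add: spectral_space_def)
    note r = repr[OF f integrable_decay_mult_Lp[OF t(1) p fp]]
    note sampling_Lp[OF t(1) c Q_def Q1 p meas osc r fp]
    then show "(\<lambda>\<xi>. measure \<mu> (A \<xi>) * norm (f \<xi>) powr p) summable_on X"
      "((1 - Q) * Lp_norm \<mu> (ennreal p) f) powr p \<le> (\<Sum>\<^sub>\<infinity>\<xi>\<in>X. measure \<mu> (A \<xi>) * norm (f \<xi>) powr p)"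
      "(\<Sum>\<^sub>\<infinity>\<xi>\<in>X. measure \<mu> (A \<xi>) * norm (f \<xi>) powr p) \<le> ((1 + Q) * Lp_norm \<mu> (ennreal p) f) powr p"
      by blast+
  qed

  have norm0: "0 \<le> Lp_norm \<mu> p f" for p f by (simp add: Lp_norm_def)

  have part1: "(\<lambda>\<xi>. measure \<mu> (A \<xi>) * norm (f \<xi>) powr p) summable_on X \<and>
           1 / 2 * Lp_norm \<mu> (ennreal p) f
             \<le> (\<Sum>\<^sub>\<infinity>\<xi>\<in>X. measure \<mu> (A \<xi>) * norm (f \<xi>) powr p) powr (1 / p) \<and>
           (\<Sum>\<^sub>\<infinity>\<xi>\<in>X. measure \<mu> (A \<xi>) * norm (f \<xi>) powr p) powr (1 / p)
             \<le> 2 * Lp_norm \<mu> (ennreal p) f"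
    if Q2: "Q \<le> 1 / 2" and p: "1 \<le> p" and f: "f \<in> spectral_space \<mu> L lam (ennreal p)" for p f
  proof -
    let ?S = "\<Sum>\<^sub>\<infinity>\<xi>\<in>X. measure \<mu> (A \<xi>) * norm (f \<xi>) powr p" and ?N = "Lp_norm \<mu> (ennreal p) f"
    have "Q < 1" using Q2 by simp
    note est = finite_p[OF this p f]
    have S0: "0 \<le> ?S" by (intro infsum_nonneg) simp
    have "1 / 2 * ?N \<le> (1 - Q) * ?N" using Q2 by (intro mult_right_mono norm0) simp
    also have "\<dots> = (((1 - Q) * ?N) powr p) powr (1 / p)"
      using p Q2 norm0 by (simp add: powr_powr)
    also have "\<dots> \<le> ?S powr (1 / p)" using est(2) p by (intro powr_mono2) auto
    finally have lower: "1 / 2 * ?N \<le> ?S powr (1 / p)" .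
    have "?S powr (1 / p) \<le> (((1 + Q) * ?N) powr p) powr (1 / p)"
      using est(3) p S0 by (intro powr_mono2) auto
    also have "\<dots> = (1 + Q) * ?N" using p Q0 norm0 by (simp add: powr_powr)
    also have "\<dots> \<le> 2 * ?N" using Q2 by (intro mult_right_mono norm0) simp
    finally show ?thesis using lower est(1) by blast
  qed

  have part2: "bdd_above ((\<lambda>\<xi>. norm (f \<xi>)) ` X) \<and>
           1 / 2 * Lp_norm \<mu> \<infinity> f \<le> (SUP \<xi>\<in>X. norm (f \<xi>)) \<and>
           (SUP \<xi>\<in>X. norm (f \<xi>)) \<le> Lp_norm \<mu> \<infinity> f"
    if Q2: "Q \<le> 1 / 2" and f: "f \<in> spectral_space \<mu> L lam \<infinity>" for f
  proof -
    have fi: "f \<in> Lp_space \<mu> \<infinity>" and cont: "continuous_on UNIV f"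
      using f by (auto simp: spectral_space_def)
    have r: "has_bochner_integral \<mu> (\<lambda>y. \<Phi> t x y * f y) (f x)" for x
      by (rule repr[OF f integrable_decay_mult_bounded[OF t(1) borel_measurable_continuous[OF cont]
              norm_le_Lp_norm_infinity[OF fi cont]]])
    note est = sampling_sup[OF t(1) c Q_def osc r fi cont]
    have "1 / 2 * Lp_norm \<mu> \<infinity> f \<le> (1 - Q) * Lp_norm \<mu> \<infinity> f"
      using Q2 by (intro mult_right_mono norm0) simp
    with est show ?thesis by linarith
  qed

  have part3: "(\<lambda>\<xi>. measure \<mu> (A \<xi>) * norm (f \<xi>) powr p) summable_on X \<and>
           (1 - \<epsilon>) * Lp_norm \<mu> (ennreal p) f powr p
             \<le> (\<Sum>\<^sub>\<infinity>\<xi>\<in>X. measure \<mu> (A \<xi>) * norm (f \<xi>) powr p) \<and>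
           (\<Sum>\<^sub>\<infinity>\<xi>\<in>X. measure \<mu> (A \<xi>) * norm (f \<xi>) powr p)
             \<le> (1 + \<epsilon>) * Lp_norm \<mu> (ennreal p) f powr p"
    if \<epsilon>: "0 < \<epsilon>" "\<epsilon> < 1" and Q3: "Q \<le> \<epsilon> / 3" and p: "1 \<le> p" "p \<le> 2"
      and f: "f \<in> spectral_space \<mu> L lam (ennreal p)" for \<epsilon> p f
  proof -
    let ?N = "Lp_norm \<mu> (ennreal p) f"
    have Q1: "Q < 1" using Q3 \<epsilon> by simp
    note est = finite_p[OF Q1 p(1) f]
    \<comment> \<open>For \<open>p \<le> 2\<close> both factors \<open>(1 \<plusminus> Q)\<^sup>p\<close> are no further from \<open>1\<close> than \<open>(1 \<plusminus> Q)\<^sup>2\<close>, and \<open>Q\<^sup>2 \<le> Q\<close>.\<close>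
    have "1 - \<epsilon> \<le> 1 - 2 * Q" using Q3 \<epsilon> by simp
    also have "\<dots> \<le> (1 - Q) powr 2" using Q1 by (simp add: power2_eq_square algebra_simps)
    also have "\<dots> \<le> (1 - Q) powr p" using p Q0 Q1 by (intro powr_mono') auto
    finally have "(1 - \<epsilon>) * ?N powr p \<le> (1 - Q) powr p * ?N powr p" by (rule mult_right_mono) simp
    also have "\<dots> = ((1 - Q) * ?N) powr p" by (simp add: powr_mult)
    finally have lower: "(1 - \<epsilon>) * ?N powr p \<le> ((1 - Q) * ?N) powr p" .
    have "(1 + Q) powr p \<le> (1 + Q) powr 2" using p Q0 by (intro powr_mono) auto
    also have "\<dots> = 1 + 2 * Q + Q * Q" using Q0 by (simp add: power2_eq_square algebra_simps)
    also have "Q * Q \<le> Q * 1" using Q0 Q1 by (intro mult_left_mono) auto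
    then have "1 + 2 * Q + Q * Q \<le> 1 + \<epsilon>" using Q3 by simp
    finally have "(1 + Q) powr p * ?N powr p \<le> (1 + \<epsilon>) * ?N powr p" by (rule mult_right_mono) simp
    then have upper: "((1 + Q) * ?N) powr p \<le> (1 + \<epsilon>) * ?N powr p" by (simp add: powr_mult)
    show ?thesis using est lower upper by linarith
  qed

  have Q_eq: "K \<sigma>\<^sub>0 * \<gamma> powr \<alpha> * 2 powr (2 * d + 1) = Q"
    by (simp add: Q_def c_def)
  show ?thesis
    unfolding Q_eq
    by (rule conjI, rule impI, rule conjI)
      ((intro allI impI, rule part1; assumption), (intro ballI, rule part2; assumption),
        (intro allI impI, rule part3; assumption))
qed

end
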